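(* The (decision version of the) bottleneck bitonic TSP on $n$ points in the Euclidean plane has a lower bound of $\Omega(n\log n)$ in the algebraic computation tree model: deciding, for a set $P$ of $n$ points in the plane with distinct $x$-coordinates and a value $B>0$, whether $P$ admits a bitonic tour whose longest edge has Euclidean length at most $B$, requires $\Omega(n\log n)$ time in this model.
   Context: A bitonic tour of a point set with distinct $x$-coordinates is a tour that starts at the leftmost point, goes strictly rightward to the rightmost point, and then goes strictly leftward back to the starting point; equivalently, a pyramidal tour with respect to the left-to-right order of the points. *)

theory Defs
  imports Complex_Main
begin

type_synonym point = "real \<times> real"

definition edist :: "point \<Rightarrow> point \<Rightarrow> real" where
  "edist p q = sqrt ((fst p - fst q)^2 + (snd p - snd q)^2)"

text \<open>A tour of the points ps (indexed 0..n-1) is given by a list sigma listing each index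
  exactly once; its edges join consecutive entries cyclically. It is bitonic if it starts at
  the leftmost point, the x-coordinates strictly increase up to some position k and strictly
  decrease from position k to the end (then the closing edge returns leftward to the start).\<close>

definition is_tour :: "point list \<Rightarrow> nat list \<Rightarrow> bool" where
  "is_tour ps \<sigma> \<longleftrightarrow> ps \<noteq> [] \<and> distinct \<sigma> \<and> set \<sigma> = {0..<length ps}"

definition bitonic_tour :: "point list \<Rightarrow> nat list \<Rightarrow> bool" where
  "bitonic_tour ps \<sigma> \<longleftrightarrow> is_tour ps \<sigma> \<and>
     (\<forall>j<length \<sigma>. fst (ps ! (\<sigma> ! 0)) \<le> fst (ps ! (\<sigma> ! j))) \<and>
     (\<exists>k<length \<sigma>.
        (\<forall>i j. i < j \<and> j \<le> k \<longrightarrow> fst (ps ! (\<sigma> ! i)) < fst (ps ! (\<sigma> ! j))) \<and>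
        (\<forall>i j. k \<le> i \<and> i < j \<and> j < length \<sigma> \<longrightarrow> fst (ps ! (\<sigma> ! i)) > fst (ps ! (\<sigma> ! j))))"

definition bottleneck :: "point list \<Rightarrow> nat list \<Rightarrow> real" where
  "bottleneck ps \<sigma> =
     Max ((\<lambda>i. edist (ps ! (\<sigma> ! i)) (ps ! (\<sigma> ! ((i + 1) mod length \<sigma>)))) ` {0..<length \<sigma>})"

definition btsp_yes :: "point list \<Rightarrow> real \<Rightarrow> bool" where
  "btsp_yes ps B \<longleftrightarrow> (\<exists>\<sigma>. bitonic_tour ps \<sigma> \<and> bottleneck ps \<sigma> \<le> B)"

datatype operand = Reg nat | Cst real

datatype arith_op = Add | Sub | Mul | Div

datatype act =
    Leaf bool
  | Arith arith_op operand operand act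
  | Sqrt operand act
  | Branch operand act act act

fun opnd :: "real list \<Rightarrow> operand \<Rightarrow> real option" where
  "opnd m (Reg i) = (if i < length m then Some (m ! i) else None)"
| "opnd m (Cst c) = Some c"

fun apply_op :: "arith_op \<Rightarrow> real \<Rightarrow> real \<Rightarrow> real option" where
  "apply_op Add u v = Some (u + v)"
| "apply_op Sub u v = Some (u - v)"
| "apply_op Mul u v = Some (u * v)"
| "apply_op Div u v = (if v = 0 then None else Some (u / v))"

fun act_eval :: "act \<Rightarrow> real list \<Rightarrow> bool option" where
  "act_eval (Leaf b) m = Some b"
| "act_eval (Arith f a b T) m =
     (case (opnd m a, opnd m b) of
        (Some u, Some v) \<Rightarrow> (case apply_op f u v of Some w \<Rightarrow> act_eval T (m @ [w]) | None \<Rightarrow> None)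
      | _ \<Rightarrow> None)"
| "act_eval (Sqrt a T) m =
     (case opnd m a of Some u \<Rightarrow> (if u < 0 then None else act_eval T (m @ [sqrt u])) | None \<Rightarrow> None)"
| "act_eval (Branch a L E G) m =
     (case opnd m a of
        Some u \<Rightarrow> (if u < 0 then act_eval L m else if u = 0 then act_eval E m else act_eval G m)
      | None \<Rightarrow> None)"

fun act_depth :: "act \<Rightarrow> nat" where
  "act_depth (Leaf b) = 0"
| "act_depth (Arith f a b T) = Suc (act_depth T)"
| "act_depth (Sqrt a T) = Suc (act_depth T)"
| "act_depth (Branch a L E G) = Suc (max (act_depth L) (max (act_depth E) (act_depth G)))"

definition encode :: "point list \<Rightarrow> real \<Rightarrow> real list" where
  "encode ps B = concat (map (\<lambda>p. [fst p, snd p]) ps) @ [B]"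

definition decides_btsp :: "nat \<Rightarrow> act \<Rightarrow> bool" where
  "decides_btsp n T \<longleftrightarrow>
     (\<forall>ps B. length ps = n \<and> distinct (map fst ps) \<and> B > 0 \<longrightarrow>
        act_eval T (encode ps B) = Some (btsp_yes ps B))"

end

theory Submission
  imports Defs "HOL-Analysis.Analysis" "HOL-Combinatorics.Permutations" "HOL-Real_Asymp.Real_Asymp"
begin

text \<open>
  Take \<open>n\<close> points on the x-axis with \<open>B = 1\<close>: the points \<open>0\<close> and \<open>k\<close>, about \<open>k\<close> half-integers, and
  \<open>k - 1\<close> free points, where \<open>k = (n - 1) div 2\<close>. A tour with edges of length at most 1 exists only
  if the free points are a permutation of \<open>1, \<dots>, k - 1\<close>, so the accepted inputs of this shape are
  \<open>(k - 1)!\<close> isolated points.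

  Along a path of the tree, the registers together with the inputs satisfy a system of quadratic
  equations in \<open>m \<le> 2n + 1 + depth\<close> variables; let \<open>F\<close> be the sum of their squares, so that the
  accepted inputs give isolated zeros of \<open>F\<close>. There are at most \<open>5 ^ m\<close> of them: by a local-minimum
  argument the equation \<open>grad F = y\<close> is solvable near each zero for all small \<open>y\<close>. A linear form
  \<open>l\<close> separating the zeros is algebraic of degree at most \<open>5 ^ m\<close> over the components of
  \<open>grad F\<close>, by counting monomials, and for generic \<open>y\<close> the values of \<open>l\<close> at the solutions are
  distinct roots of the resulting univariate polynomial. This replaces the Milnor-Thom bound in
  Ben-Or's argument. With at most \<open>3 ^ depth\<close> paths,
  \<open>(k - 1)! \<le> 3 ^ depth * 5 ^ (2n + 1 + depth)\<close>.
\<close>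

section \<open>Polynomial functions\<close>

inductive poly_fun :: "nat \<Rightarrow> nat \<Rightarrow> ((nat \<Rightarrow> real) \<Rightarrow> real) \<Rightarrow> bool" for m where
  const: "poly_fun m d (\<lambda>_. c)"
| var: "i < m \<Longrightarrow> poly_fun m (Suc d) (\<lambda>x. x i)"
| add: "poly_fun m d f \<Longrightarrow> poly_fun m d g \<Longrightarrow> poly_fun m d (\<lambda>x. f x + g x)"
| mult: "poly_fun m d f \<Longrightarrow> poly_fun m e g \<Longrightarrow> d + e \<le> k \<Longrightarrow> poly_fun m k (\<lambda>x. f x * g x)"

lemma poly_fun_mono: "poly_fun m d f \<Longrightarrow> m \<le> m' \<Longrightarrow> d \<le> d' \<Longrightarrow> poly_fun m' d' f"
proof (induction arbitrary: d' rule: poly_fun.induct)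
  case (const d c)
  show ?case by (rule poly_fun.const)
next
  case (var i d)
  then obtain e where "d' = Suc e" by (cases d') auto
  then show ?case using var by (simp add: poly_fun.var)
next
  case (add d f g)
  then show ?case by (simp add: poly_fun.add)
next
  case (mult d f e g k)
  then have "poly_fun m' d f" "poly_fun m' e g" by auto
  then show ?case by (rule poly_fun.mult) (use mult in simp)
qed

lemma poly_fun_cong: "poly_fun m d f \<Longrightarrow> (\<And>i. i < m \<Longrightarrow> x i = y i) \<Longrightarrow> f x = f y"
  by (induction rule: poly_fun.induct) auto

lemma poly_fun_diff:
  assumes "poly_fun m d f" "poly_fun m d g"
  shows "poly_fun m d (\<lambda>x. f x - g x)"
proof -
  have "poly_fun m d (\<lambda>x. (-1) * g x)"
    using poly_fun.mult[OF poly_fun.const[of m 0 "-1"] assms(2)] by simp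
  from poly_fun.add[OF assms(1) this] show ?thesis by simp
qed

lemma poly_fun_sum:
  assumes "\<And>a. a \<in> S \<Longrightarrow> poly_fun m d (f a)"
  shows "poly_fun m d (\<lambda>x. \<Sum>a\<in>S. f a x)"
  using assms
  by (induction S rule: infinite_finite_induct) (auto intro: poly_fun.intros)

lemma poly_fun_power:
  assumes "poly_fun m d f"
  shows "poly_fun m (d * k) (\<lambda>x. f x ^ k)"
proof (induction k)
  case 0
  then show ?case by (simp add: poly_fun.const)
next
  case (Suc k)
  show ?case using poly_fun.mult[OF assms Suc] by simp
qed

lemma poly_fun_prod:
  fixes n :: nat
  assumes "\<And>i. i < n \<Longrightarrow> poly_fun m (d i) (f i)"
  shows "poly_fun m (\<Sum>i<n. d i) (\<lambda>x. \<Prod>i<n. f i x)"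
  using assms
proof (induction n)
  case 0
  then show ?case by (simp add: poly_fun.const)
next
  case (Suc n)
  then show ?case
    using poly_fun.mult[of m "\<Sum>i<n. d i" "\<lambda>x. \<Prod>i<n. f i x" "d n" "f n"] by simp
qed

lemma poly_fun_continuous_on: "poly_fun m d f \<Longrightarrow> continuous_on S f"
  by (induction rule: poly_fun.induct)
     (auto intro!: continuous_intros intro: continuous_on_subset[OF continuous_on_product_coordinates])

lemma poly_fun_has_partial_derivative:
  "poly_fun m d f \<Longrightarrow>
    \<exists>g. poly_fun m d g \<and> (\<forall>x. ((\<lambda>t. f (x(i := t))) has_real_derivative g x) (at (x i)))"
proof (induction rule: poly_fun.induct)
  case (const d c)
  show ?case by (rule exI[of _ "\<lambda>_. 0"]) (auto intro: poly_fun.const)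
next
  case (var j d)
  show ?case
    by (rule exI[of _ "\<lambda>_. if j = i then 1 else 0"])
       (auto intro: poly_fun.const derivative_eq_intros)
next
  case (add d f g)
  then obtain f' g' where
    "poly_fun m d f'" "\<And>x. ((\<lambda>t. f (x(i := t))) has_real_derivative f' x) (at (x i))"
    "poly_fun m d g'" "\<And>x. ((\<lambda>t. g (x(i := t))) has_real_derivative g' x) (at (x i))"
    by blast
  then show ?case
    by (intro exI[of _ "\<lambda>x. f' x + g' x"]) (intro conjI allI poly_fun.add DERIV_add; blast)
next
  case (mult d f e g k)
  then obtain f' g' where
    "poly_fun m d f'" "\<And>x. ((\<lambda>t. f (x(i := t))) has_real_derivative f' x) (at (x i))"
    "poly_fun m e g'" "\<And>x. ((\<lambda>t. g (x(i := t))) has_real_derivative g' x) (at (x i))"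
    by blast
  moreover from this have "poly_fun m k (\<lambda>x. f' x * g x + g' x * f x)"
    using mult.hyps
    by (intro poly_fun.add poly_fun.mult[of m d f' e g] poly_fun.mult[of m e g' d f])
      (auto simp: add.commute)
  moreover have "((\<lambda>t. f (x(i := t)) * g (x(i := t))) has_real_derivative f' x * g x + g' x * f x)
      (at (x i))" for x
    using DERIV_mult[OF calculation(2)[of x] calculation(4)[of x]] by simp
  ultimately show ?case by blast
qed

definition exps :: "nat \<Rightarrow> nat \<Rightarrow> (nat \<Rightarrow> nat) set" where
  "exps m d = {\<alpha>. (\<forall>i\<ge>m. \<alpha> i = 0) \<and> (\<Sum>i<m. \<alpha> i) \<le> d}"

lemma exps_le: "\<alpha> \<in> exps m d \<Longrightarrow> \<alpha> i \<le> d"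
  using member_le_sum[of i "{..<m}" \<alpha>] by (cases "i < m") (auto simp: exps_def)

lemma finite_exps: "finite (exps m d)"
proof (rule finite_subset)
  show "exps m d \<subseteq> {\<alpha>. \<forall>i. (i \<in> {..<m} \<longrightarrow> \<alpha> i \<in> {..d}) \<and> (i \<notin> {..<m} \<longrightarrow> \<alpha> i = 0)}"
    using exps_le by (auto simp: exps_def)
  show "finite \<dots>" by (rule finite_set_of_finite_funs) auto
qed

lemma zero_mem_exps: "(\<lambda>_. 0) \<in> exps m d"
  by (simp add: exps_def)

text \<open>Quotient and remainder modulo 5 of all exponents determine the exponent vector.\<close>

lemma card_exps_le: "card (exps m (5 * k)) \<le> 5 ^ m * card (exps m k)"
proof -
  let ?\<phi> = "\<lambda>\<alpha>::nat\<Rightarrow>nat. (\<lambda>i. \<alpha> i div 5, \<lambda>i\<in>{..<m}. \<alpha> i mod 5)"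
  let ?T = "exps m k \<times> ({..<m} \<rightarrow>\<^sub>E {..<5::nat})"
  have "inj_on ?\<phi> (exps m (5 * k))"
  proof (rule inj_onI)
    fix \<alpha> \<beta> assume \<alpha>: "\<alpha> \<in> exps m (5 * k)" and \<beta>: "\<beta> \<in> exps m (5 * k)" and eq: "?\<phi> \<alpha> = ?\<phi> \<beta>"
    show "\<alpha> = \<beta>"
    proof
      fix i
      show "\<alpha> i = \<beta> i"
      proof (cases "i < m")
        case True
        have "\<alpha> i div 5 = \<beta> i div 5" using eq by (auto dest: fun_cong)
        moreover have "\<alpha> i mod 5 = \<beta> i mod 5"
          using eq True by (auto dest!: fun_cong[of _ _ i])
        ultimately show ?thesis by (metis div_mod_decomp)
      qed (use \<alpha> \<beta> in \<open>auto simp: exps_def\<close>)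
    qed
  qed
  moreover have "?\<phi> ` exps m (5 * k) \<subseteq> ?T"
  proof -
    have "(\<Sum>i<m. \<alpha> i div 5) \<le> k" if "\<alpha> \<in> exps m (5 * k)" for \<alpha>
    proof -
      have "5 * (\<Sum>i<m. \<alpha> i div 5) \<le> (\<Sum>i<m. \<alpha> i)"
        unfolding sum_distrib_left by (rule sum_mono) simp
      then show ?thesis using that by (simp add: exps_def)
    qed
    then show ?thesis by (auto simp: exps_def PiE_def extensional_def)
  qed
  moreover have "finite ?T" by (simp add: finite_exps finite_PiE)
  ultimately have "card (exps m (5 * k)) \<le> card ?T" by (rule card_inj_on_le)
  also have "\<dots> = 5 ^ m * card (exps m k)"
    by (simp add: card_cartesian_product card_PiE)
  finally show ?thesis .
qed

definition monom_fun :: "nat \<Rightarrow> (nat \<Rightarrow> nat) \<Rightarrow> (nat \<Rightarrow> real) \<Rightarrow> real" where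
  "monom_fun m \<alpha> x = (\<Prod>i<m. x i ^ \<alpha> i)"

lemma poly_fun_expansion:
  "poly_fun m d f \<Longrightarrow> \<exists>c. \<forall>x. f x = (\<Sum>\<alpha>\<in>exps m d. c \<alpha> * monom_fun m \<alpha> x)"
proof (induction rule: poly_fun.induct)
  case (const d c)
  have "c = (\<Sum>\<alpha>\<in>exps m d. (if \<alpha> = (\<lambda>_. 0) then c else 0) * monom_fun m \<alpha> x)" for x
    using zero_mem_exps finite_exps
    by (simp add: if_distrib[of "\<lambda>t. t * _"] sum.delta monom_fun_def cong: if_cong)
  then show ?case by (intro exI[of _ "\<lambda>\<alpha>. if \<alpha> = (\<lambda>_. 0) then c else 0"]) blast
next
  case (var i d)
  let ?\<beta> = "\<lambda>j. if j = i then 1 else 0 :: nat"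
  have "?\<beta> \<in> exps m (Suc d)" using var by (simp add: exps_def)
  moreover have "monom_fun m ?\<beta> x = x i" for x
  proof -
    have "monom_fun m ?\<beta> x = (\<Prod>j<m. if j = i then x j else 1)"
      unfolding monom_fun_def by (rule prod.cong) auto
    then show ?thesis using var by simp
  qed
  ultimately have "x i = (\<Sum>\<alpha>\<in>exps m (Suc d). (if \<alpha> = ?\<beta> then 1 else 0) * monom_fun m \<alpha> x)" for x
    using finite_exps by (simp add: if_distrib[of "\<lambda>t. t * _"] sum.delta cong: if_cong)
  then show ?case by (intro exI[of _ "\<lambda>\<alpha>. if \<alpha> = ?\<beta> then 1 else 0"]) blast
next
  case (add d f g)
  then obtain c c' where
    "\<And>x. f x = (\<Sum>\<alpha>\<in>exps m d. c \<alpha> * monom_fun m \<alpha> x)"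
    "\<And>x. g x = (\<Sum>\<alpha>\<in>exps m d. c' \<alpha> * monom_fun m \<alpha> x)" by auto
  then show ?case
    by (intro exI[of _ "\<lambda>\<alpha>. c \<alpha> + c' \<alpha>"]) (simp add: sum.distrib distrib_right)
next
  case (mult d f e g k)
  then obtain c c' where
    f: "\<And>x. f x = (\<Sum>\<alpha>\<in>exps m d. c \<alpha> * monom_fun m \<alpha> x)" and
    g: "\<And>x. g x = (\<Sum>\<alpha>\<in>exps m e. c' \<alpha> * monom_fun m \<alpha> x)" by auto
  let ?P = "exps m d \<times> exps m e"
  let ?s = "\<lambda>(\<alpha>, \<beta>) i. \<alpha> i + \<beta> i :: nat"
  let ?C = "\<lambda>\<gamma>. \<Sum>p\<in>{p\<in>?P. ?s p = \<gamma>}. c (fst p) * c' (snd p)"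
  have fin: "finite ?P" by (simp add: finite_exps)
  have img: "?s ` ?P \<subseteq> exps m k"
    using mult.hyps by (fastforce simp: exps_def sum.distrib)
  have "f x * g x = (\<Sum>\<gamma>\<in>exps m k. ?C \<gamma> * monom_fun m \<gamma> x)" for x
  proof -
    have "f x * g x = (\<Sum>p\<in>?P. c (fst p) * c' (snd p) * monom_fun m (?s p) x)"
      unfolding f g sum_product sum.cartesian_product
      by (rule sum.cong) (auto simp: monom_fun_def power_add prod.distrib)
    also have "\<dots> = (\<Sum>\<gamma>\<in>exps m k. \<Sum>p\<in>{p\<in>?P. ?s p = \<gamma>}. c (fst p) * c' (snd p) * monom_fun m (?s p) x)"
      by (rule sum.group[symmetric, OF fin finite_exps img])
    also have "\<dots> = (\<Sum>\<gamma>\<in>exps m k. ?C \<gamma> * monom_fun m \<gamma> x)"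
      unfolding sum_distrib_right by (intro sum.cong) auto
    finally show ?thesis .
  qed
  then show ?case by (intro exI[of _ ?C]) blast
qed

lemma inj_on_radix: "inj_on (\<lambda>\<alpha>. \<Sum>i<m. \<alpha> i * Suc k ^ i) (exps m k)"
proof (rule inj_onI)
  fix \<alpha> \<beta> assume \<alpha>: "\<alpha> \<in> exps m k" and \<beta>: "\<beta> \<in> exps m k"
    and eq: "(\<Sum>i<m. \<alpha> i * Suc k ^ i) = (\<Sum>i<m. \<beta> i * Suc k ^ i)"
  have "(\<Sum>i<j. a i * Suc k ^ i) = (\<Sum>i<j. b i * Suc k ^ i) \<Longrightarrow> \<forall>i<j. a i = b i"
    if "\<forall>i. a i \<le> k" "\<forall>i. b i \<le> k" for j and a b :: "nat \<Rightarrow> nat"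
    using that
  proof (induction j arbitrary: a b)
    case (Suc j)
    have shift: "(\<Sum>i<Suc j. a i * Suc k ^ i) = a 0 + Suc k * (\<Sum>i<j. a (Suc i) * Suc k ^ i)"
      for a :: "nat \<Rightarrow> nat"
      by (subst sum.lessThan_Suc_shift) (simp add: sum_distrib_left algebra_simps del: sum.lessThan_Suc)
    let ?S = "\<lambda>a. \<Sum>i<j. a (Suc i) * Suc k ^ i"
    have lt: "a 0 < Suc k" "b 0 < Suc k" using Suc.prems by (auto simp: less_Suc_eq_le)
    have eq: "a 0 + Suc k * ?S a = b 0 + Suc k * ?S b"
      using Suc.prems(1) unfolding shift .
    have "(a 0 + Suc k * ?S a) mod Suc k = a 0" "(b 0 + Suc k * ?S b) mod Suc k = b 0"
      using lt by (simp_all only: mod_mult_self2 mod_less)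
    then have 0: "a 0 = b 0" using eq by metis
    then have "Suc k * ?S a = Suc k * ?S b" using eq by (simp only: add_left_cancel)
    then have "?S a = ?S b" by (simp only: mult_cancel1) auto
    then have "\<forall>i<j. a (Suc i) = b (Suc i)"
      by (rule Suc.IH) (use Suc.prems in auto)
    then show ?case using 0 by (metis less_Suc_eq_0_disj)
  qed auto
  from this[OF _ _ eq] have "\<forall>i<m. \<alpha> i = \<beta> i" using \<alpha> \<beta> exps_le by blast
  then show "\<alpha> = \<beta>" using \<alpha> \<beta> by (auto simp: exps_def fun_eq_iff) (metis not_le)
qed

text \<open>Kronecker substitution of \<open>s ^ (k + 1) ^ i\<close> for the \<open>i\<close>-th variable turns the polynomial
  into a univariate one with the same coefficients.\<close>

lemma polynomial_nonzero_near_0: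
  assumes v: "\<beta> \<in> exps m k" "v \<beta> \<noteq> 0" and \<eta>: "\<eta> > 0"
  obtains y where "\<And>i. 0 < y i \<and> y i < \<eta>" "(\<Sum>\<alpha>\<in>exps m k. v \<alpha> * monom_fun m \<alpha> y) \<noteq> 0"
proof -
  let ?e = "\<lambda>\<alpha>. \<Sum>i<m. \<alpha> i * Suc k ^ i"
  define n where "n = Max (?e ` exps m k)"
  define c where "c j = (\<Sum>\<alpha>\<in>{\<alpha>\<in>exps m k. ?e \<alpha> = j}. v \<alpha>)" for j
  have img: "?e ` exps m k \<subseteq> {..n}"
    using finite_exps by (auto simp: n_def)
  have mon: "monom_fun m \<alpha> (\<lambda>i. s ^ (Suc k ^ i)) = s ^ ?e \<alpha>" for \<alpha> and s :: real
    unfolding monom_fun_def power_sum by (simp add: power_mult[symmetric] mult.commute)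
  have eq: "(\<Sum>\<alpha>\<in>exps m k. v \<alpha> * monom_fun m \<alpha> (\<lambda>i. s ^ (Suc k ^ i))) = (\<Sum>j\<le>n. c j * s ^ j)"
    (is "?L = _") for s :: real
  proof -
    have "?L = (\<Sum>j\<le>n. \<Sum>\<alpha>\<in>{\<alpha>\<in>exps m k. ?e \<alpha> = j}. v \<alpha> * s ^ ?e \<alpha>)"
      unfolding mon by (rule sum.group[symmetric, OF finite_exps _ img]) simp
    also have "\<dots> = (\<Sum>j\<le>n. c j * s ^ j)"
      unfolding c_def sum_distrib_right by (intro sum.cong) auto
    finally show ?thesis .
  qed
  have "{\<alpha>\<in>exps m k. ?e \<alpha> = ?e \<beta>} = {\<beta>}"
    using v(1) inj_onD[OF inj_on_radix] by blast
  then have "c (?e \<beta>) \<noteq> 0" using v(2) by (simp add: c_def)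
  moreover have "?e \<beta> \<le> n" using img v(1) by auto
  ultimately have "finite {s::real. (\<Sum>j\<le>n. c j * s ^ j) = 0}" (is "finite ?Z")
    using polyfun_roots_finite[of c "?e \<beta>" n] by blast
  moreover have "infinite {0<..<min \<eta> 1}" using \<eta> by (simp add: infinite_Ioo)
  ultimately have "infinite ({0<..<min \<eta> 1} - ?Z)" by simp
  then obtain s where s: "s \<in> {0<..<min \<eta> 1} - ?Z"
    using infinite_imp_nonempty by blast
  have "0 < s ^ (Suc k ^ i) \<and> s ^ (Suc k ^ i) < \<eta>" for i
  proof -
    have "s ^ (Suc k ^ i) \<le> s ^ 1" using s by (intro power_decreasing) auto
    then show ?thesis using s by auto
  qed
  moreover have "(\<Sum>\<alpha>\<in>exps m k. v \<alpha> * monom_fun m \<alpha> (\<lambda>i. s ^ (Suc k ^ i))) \<noteq> 0"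
    using s by (simp add: eq)
  ultimately show ?thesis by (rule that)
qed

lemma underdetermined_system:
  fixes M :: "'a \<Rightarrow> 'b \<Rightarrow> real"
  assumes "finite B" "finite A" "card B < card A"
  shows "\<exists>v. (\<exists>a\<in>A. v a \<noteq> 0) \<and> (\<forall>b\<in>B. (\<Sum>a\<in>A. v a * M a b) = 0)"
  using assms
proof (induction B arbitrary: A M rule: finite_induct)
  case empty
  then obtain a where "a \<in> A" by fastforce
  then show ?case by (intro exI[of _ "\<lambda>_. 1"]) auto
next
  case (insert b B)
  show ?case
  proof (cases "\<forall>a\<in>A. M a b = 0")
    case True
    then show ?thesis using insert.IH[of A M] insert.prems insert.hyps by auto
  next
    case False
    then obtain p where p: "p \<in> A" "M p b \<noteq> 0" by blast
    have "card B < card (A - {p})" using insert p by simp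
    then obtain v where v: "\<exists>a\<in>A - {p}. v a \<noteq> 0"
      "\<forall>b'\<in>B. (\<Sum>a\<in>A - {p}. v a * (M a b' - M a b / M p b * M p b')) = 0"
      using insert.IH[of "A - {p}" "\<lambda>a b'. M a b' - M a b / M p b * M p b'"] insert.prems by auto
    define w where "w = v(p := - (\<Sum>a\<in>A - {p}. v a * M a b / M p b))"
    have *: "(\<Sum>a\<in>A. w a * M a b') = (\<Sum>a\<in>A - {p}. v a * (M a b' - M a b / M p b * M p b'))" for b'
    proof -
      have "(\<Sum>a\<in>A - {p}. w a * M a b') = (\<Sum>a\<in>A - {p}. v a * M a b')"
        by (rule sum.cong) (auto simp: w_def)
      then have "(\<Sum>a\<in>A. w a * M a b') = w p * M p b' + (\<Sum>a\<in>A - {p}. v a * M a b')"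
        using p insert.prems by (simp add: sum.remove)
      then show ?thesis
        by (simp add: w_def sum_distrib_right right_diff_distrib sum_subtractf mult.assoc)
    qed
    have "(\<Sum>a\<in>A. w a * M a b') = 0" if "b' \<in> insert b B" for b'
      using that v(2) p by (auto simp: *)
    moreover have "\<exists>a\<in>A. w a \<noteq> 0" using v(1) by (auto simp: w_def)
    ultimately show ?thesis by blast
  qed
qed

section \<open>Counting isolated zeros\<close>

lemma algebraic_relation:
  assumes G: "\<And>i. i < m \<Longrightarrow> poly_fun m 4 (G i)" and l: "poly_fun m 1 l"
  obtains v \<beta> j where "j \<le> 5 ^ m" "\<beta> \<in> exps m (5 ^ m)" "v j \<beta> \<noteq> 0"
    "\<And>x. (\<Sum>j\<le>5 ^ m. (\<Sum>\<beta>\<in>exps m (5 ^ m). v j \<beta> * monom_fun m \<beta> (\<lambda>i. G i x)) * l x ^ j) = 0"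
proof -
  define J :: nat where "J = 5 ^ m"
  let ?A = "{..J} \<times> exps m J"
  let ?h = "\<lambda>p x. l x ^ fst p * monom_fun m (snd p) (\<lambda>i. G i x)"
  have "\<exists>c. \<forall>x. ?h p x = (\<Sum>\<alpha>\<in>exps m (5 * J). c \<alpha> * monom_fun m \<alpha> x)" if p_mem: "p \<in> ?A" for p
  proof -
    obtain j \<beta> where p: "p = (j, \<beta>)" "j \<le> J" "\<beta> \<in> exps m J" using p_mem by auto
    have 1: "poly_fun m (1 * j) (\<lambda>x. l x ^ j)" by (rule poly_fun_power[OF l])
    have 2: "poly_fun m (\<Sum>i<m. 4 * \<beta> i) (\<lambda>x. \<Prod>i<m. G i x ^ \<beta> i)"
      by (intro poly_fun_prod poly_fun_power G)
    have "1 * j + (\<Sum>i<m. 4 * \<beta> i) \<le> 5 * J"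
      using p by (simp add: sum_distrib_left[symmetric] exps_def)
    from poly_fun.mult[OF 1 2 this] show ?thesis
      unfolding p monom_fun_def[symmetric] fst_conv snd_conv by (rule poly_fun_expansion)
  qed
  then have "\<exists>M. \<forall>p\<in>?A. \<forall>x. ?h p x = (\<Sum>\<alpha>\<in>exps m (5 * J). M p \<alpha> * monom_fun m \<alpha> x)"
    by (intro bchoice) blast
  then obtain M where M: "\<And>p x. p \<in> ?A \<Longrightarrow> ?h p x = (\<Sum>\<alpha>\<in>exps m (5 * J). M p \<alpha> * monom_fun m \<alpha> x)"
    by blast
  have "card (exps m J) > 0"
    using finite_exps zero_mem_exps[of m J] by (auto simp: card_gt_0_iff)
  then have "card (exps m (5 * J)) < card ?A"
    using card_exps_le[of m J] by (simp add: card_cartesian_product J_def)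
  then obtain v where v: "\<exists>p\<in>?A. v p \<noteq> 0"
    "\<And>\<alpha>. \<alpha> \<in> exps m (5 * J) \<Longrightarrow> (\<Sum>p\<in>?A. v p * M p \<alpha>) = 0"
    using underdetermined_system[of "exps m (5 * J)" ?A M] by (auto simp: finite_exps)
  have "(\<Sum>j\<le>J. (\<Sum>\<beta>\<in>exps m J. v (j, \<beta>) * monom_fun m \<beta> (\<lambda>i. G i x)) * l x ^ j) = 0" (is "?L = 0") for x
  proof -
    have "?L = (\<Sum>p\<in>?A. v p * ?h p x)"
      unfolding sum_distrib_right sum.cartesian_product by (rule sum.cong) auto
    also have "\<dots> = (\<Sum>p\<in>?A. \<Sum>\<alpha>\<in>exps m (5 * J). v p * M p \<alpha> * monom_fun m \<alpha> x)"
      by (rule sum.cong) (simp_all add: M sum_distrib_left mult.assoc)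
    also have "\<dots> = (\<Sum>\<alpha>\<in>exps m (5 * J). \<Sum>p\<in>?A. v p * M p \<alpha> * monom_fun m \<alpha> x)"
      by (rule sum.swap)
    also have "\<dots> = 0"
      unfolding sum_distrib_right[symmetric] by (simp add: v(2))
    finally show ?thesis .
  qed
  with v(1) show ?thesis
    by (auto simp: J_def intro!: that[of _ _ "\<lambda>j \<beta>. v (j, \<beta>)"])
qed

lemma separating_power_sum:
  assumes A: "finite A" and inj: "\<And>a b. a \<in> A \<Longrightarrow> b \<in> A \<Longrightarrow> (\<And>i. i < m \<Longrightarrow> a i = b i) \<Longrightarrow> a = b"
  obtains s :: real where "inj_on (\<lambda>x. \<Sum>i<m. s ^ i * x i) A"
proof -
  let ?Z = "\<lambda>a b. {s::real. (\<Sum>i\<le>m. (if i < m then a i - b i else 0) * s ^ i) = 0}"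
  have "finite (\<Union>a\<in>A. \<Union>b\<in>A - {a}. ?Z a b)"
  proof (intro finite_UN_I)
    fix a b assume ab: "a \<in> A" "b \<in> A - {a}"
    then obtain i where "i < m" "a i \<noteq> b i" using inj[of a b] by blast
    then show "finite (?Z a b)"
      by (intro polyfun_roots_finite[of _ i]) auto
  qed (use A in auto)
  then obtain s where s: "s \<notin> (\<Union>a\<in>A. \<Union>b\<in>A - {a}. ?Z a b)"
    using ex_new_if_finite[OF infinite_UNIV_char_0] by blast
  have "inj_on (\<lambda>x. \<Sum>i<m. s ^ i * x i) A"
  proof (rule inj_onI)
    fix a b assume ab: "a \<in> A" "b \<in> A" and eq: "(\<Sum>i<m. s ^ i * a i) = (\<Sum>i<m. s ^ i * b i)"
    have "(\<Sum>i\<le>m. (if i < m then a i - b i else 0) * s ^ i) = (\<Sum>i<m. (a i - b i) * s ^ i)"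
      by (rule sum.mono_neutral_cong_right) auto
    also have "\<dots> = (\<Sum>i<m. s ^ i * a i) - (\<Sum>i<m. s ^ i * b i)"
      by (simp add: sum_subtractf[symmetric] algebra_simps)
    also have "\<dots> = 0" using eq by simp
    finally show "a = b" using s ab by blast
  qed
  then show ?thesis by (rule that)
qed

text \<open>For small \<open>y\<close>, the function \<open>F x - y \<bullet> (x - a)\<close> has an interior minimum near the isolated
  zero \<open>a\<close> of \<open>F\<close>.\<close>

lemma gradient_surj_near_isolated_zero:
  assumes F: "poly_fun m d F" and nonneg: "\<And>x. 0 \<le> F x" and a: "F a = 0" and \<rho>: "\<rho> > 0"
    and iso: "\<And>x. (\<And>i. i < m \<Longrightarrow> \<bar>x i - a i\<bar> \<le> \<rho>) \<Longrightarrow> F x = 0 \<Longrightarrow> (\<forall>i<m. x i = a i)"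
    and G: "\<And>i x. i < m \<Longrightarrow> ((\<lambda>t. F (x(i := t))) has_real_derivative G i x) (at (x i))"
  obtains \<eta> where "\<eta> > 0"
    "\<And>y. (\<forall>i<m. \<bar>y i\<bar> < \<eta>) \<Longrightarrow>
      \<exists>z. (\<forall>i<m. \<bar>z i - a i\<bar> < \<rho>) \<and> (\<forall>i<m. G i z = y i)"
proof -
  define Q where "Q = (\<Pi>\<^sub>E i\<in>UNIV. if i < m then {a i - \<rho>..a i + \<rho>} else {a i})"
  have Q_iff: "x \<in> Q \<longleftrightarrow> (\<forall>i. if i < m then \<bar>x i - a i\<bar> \<le> \<rho> else x i = a i)" for x
    by (auto simp: Q_def PiE_iff abs_le_iff algebra_simps split: if_splits)
  have "compactin (product_topology (\<lambda>i. euclidean) UNIV) Q"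
    unfolding Q_def compactin_PiE by auto
  then have Q: "compact Q" by (simp add: euclidean_product_topology)
  have aQ: "a \<in> Q" using \<rho> by (simp add: Q_iff)
  define S where "S = Q \<inter> (\<Union>i<m. {x. \<rho> \<le> \<bar>x i - a i\<bar>})"
  have "closed {x :: nat \<Rightarrow> real. \<rho> \<le> \<bar>x i - a i\<bar>}" for i
    by (rule closed_Collect_le) (auto intro!: continuous_intros continuous_on_product_coordinates)
  then have "closed (\<Union>i<m. {x. \<rho> \<le> \<bar>x i - a i\<bar>})" by (intro closed_UN) auto
  then have S: "compact S" unfolding S_def using Q by (rule compact_Int_closed[rotated])
  have "\<exists>\<delta>>0. \<forall>x\<in>S. \<delta> \<le> F x"
  proof (cases "S = {}")
    case False
    then obtain x where x: "x \<in> S" "\<forall>y\<in>S. F x \<le> F y"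
      using continuous_attains_inf[OF S _ poly_fun_continuous_on[OF F]] by blast
    have "F x \<noteq> 0"
    proof
      assume "F x = 0"
      moreover have "\<bar>x i - a i\<bar> \<le> \<rho>" if "i < m" for i
        using x(1) that unfolding S_def Int_iff Q_iff by metis
      ultimately have "\<forall>i<m. x i = a i" using iso by blast
      then show False using x(1) \<rho> by (auto simp: S_def)
    qed
    then show ?thesis using x nonneg[of x] by (intro exI[of _ "F x"]) auto
  qed (auto intro: exI[of _ 1])
  then obtain \<delta> where \<delta>: "\<delta> > 0" "\<And>x. x \<in> S \<Longrightarrow> \<delta> \<le> F x" by blast
  define \<eta> where "\<eta> = \<delta> / (real m * \<rho> + 1)"
  have pos: "real m * \<rho> + 1 > 0" using \<rho> by (simp add: add_nonneg_pos)
  have "\<eta> > 0" using \<delta> pos by (simp add: \<eta>_def)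
  moreover have "\<exists>z. (\<forall>i<m. \<bar>z i - a i\<bar> < \<rho>) \<and> (\<forall>i<m. G i z = y i)"
    if y: "\<forall>i<m. \<bar>y i\<bar> < \<eta>" for y
  proof -
    define H where "H x = F x - (\<Sum>i<m. y i * (x i - a i))" for x
    have "continuous_on Q H"
      unfolding H_def
      by (intro continuous_intros poly_fun_continuous_on[OF F]
          continuous_on_subset[OF continuous_on_product_coordinates]) auto
    then obtain z where z: "z \<in> Q" "\<And>x. x \<in> Q \<Longrightarrow> H z \<le> H x"
      using continuous_attains_inf[OF Q] aQ by blast
    have "z \<notin> S"
    proof
      assume "z \<in> S"
      have "(\<Sum>i<m. y i * (z i - a i)) \<le> (\<Sum>i<m. \<eta> * \<rho>)"
      proof (rule sum_mono)
        fix i assume "i \<in> {..<m}"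
        then have "\<bar>y i\<bar> * \<bar>z i - a i\<bar> \<le> \<eta> * \<rho>"
          using y[rule_format, of i] z(1) by (intro mult_mono) (auto simp: Q_iff split: if_splits)
        then show "y i * (z i - a i) \<le> \<eta> * \<rho>" by (simp add: abs_mult[symmetric])
      qed
      also have "\<dots> = real m * \<rho> * \<delta> / (real m * \<rho> + 1)" by (simp add: \<eta>_def)
      also have "\<dots> < \<delta>" using \<delta> pos by (simp add: field_simps)
      also have "\<delta> \<le> F z" using \<delta>(2) \<open>z \<in> S\<close> .
      finally have "H z > 0" by (simp add: H_def)
      moreover have "H a = 0" by (simp add: H_def a)
      ultimately show False using z(2)[OF aQ] by simp
    qed
    then have lt: "\<bar>z i - a i\<bar> < \<rho>" if "i < m" for i
      using z(1) that by (force simp: S_def)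
    moreover have "G i z = y i" if i: "i < m" for i
    proof -
      have "((\<lambda>t. \<Sum>j<m. y j * ((z(i := t)) j - a j)) has_real_derivative
          (\<Sum>j<m. if j = i then y j else 0)) (at (z i))"
        by (intro DERIV_sum) (auto intro!: derivative_eq_intros)
      then have "((\<lambda>t. H (z(i := t))) has_real_derivative G i z - y i) (at (z i))"
        unfolding H_def using i by (intro DERIV_diff G) auto
      moreover have "0 < \<rho> - \<bar>z i - a i\<bar>" using lt[OF i] by simp
      moreover have "H (z(i := z i)) \<le> H (z(i := t))" if "\<bar>z i - t\<bar> < \<rho> - \<bar>z i - a i\<bar>" for t
      proof -
        have "\<bar>t - a i\<bar> \<le> \<rho>" using that by linarith
        then have "z(i := t) \<in> Q" using z(1) i by (auto simp: Q_iff)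
        then show ?thesis using z(2) by simp
      qed
      ultimately have "G i z - y i = 0"
        using DERIV_local_min[of "\<lambda>t. H (z(i := t))" "G i z - y i" "z i"] by blast
      then show ?thesis by simp
    qed
    ultimately show ?thesis by blast
  qed
  ultimately show ?thesis by (rule that)
qed

lemma card_isolated_zeros_le:
  assumes F: "poly_fun m 4 F" and nonneg: "\<And>x. 0 \<le> F x" and A: "finite A"
    and inj: "\<And>a b. a \<in> A \<Longrightarrow> b \<in> A \<Longrightarrow> (\<And>i. i < m \<Longrightarrow> a i = b i) \<Longrightarrow> a = b"
    and zero: "\<And>a. a \<in> A \<Longrightarrow> F a = 0"
    and iso: "\<And>a. a \<in> A \<Longrightarrow>
      \<exists>\<rho>>0. \<forall>x. (\<forall>i<m. \<bar>x i - a i\<bar> \<le> \<rho>) \<longrightarrow> F x = 0 \<longrightarrow> (\<forall>i<m. x i = a i)"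
  shows "card A \<le> 5 ^ m"
proof -
  obtain s where s: "inj_on (\<lambda>x. \<Sum>i<m. s ^ i * x i) A" (is "inj_on ?l A")
    using separating_power_sum[OF A inj] .
  have l: "poly_fun m 1 ?l"
    by (intro poly_fun_sum poly_fun.mult[OF poly_fun.const[of m 0] poly_fun.var[of _ m 0]]) auto
  obtain G where G: "\<And>i. poly_fun m 4 (G i)"
    "\<And>i x. ((\<lambda>t. F (x(i := t))) has_real_derivative G i x) (at (x i))"
    using poly_fun_has_partial_derivative[OF F] by metis
  obtain v \<beta> j where v: "j \<le> 5 ^ m" "\<beta> \<in> exps m (5 ^ m)" "v j \<beta> \<noteq> 0"
    "\<And>x. (\<Sum>j\<le>5 ^ m. (\<Sum>\<beta>\<in>exps m (5 ^ m). v j \<beta> * monom_fun m \<beta> (\<lambda>i. G i x)) * ?l x ^ j) = 0"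
    by (rule algebraic_relation[of m G ?l, OF G(1) l]) (rule that)

  have "\<forall>a\<in>A. \<forall>b\<in>A - {a}. 0 < \<bar>?l a - ?l b\<bar>" using s by (auto dest: inj_onD)
  then obtain \<epsilon> where \<epsilon>: "\<epsilon> > 0" "\<And>a b. a \<in> A \<Longrightarrow> b \<in> A \<Longrightarrow> a \<noteq> b \<Longrightarrow> \<epsilon> < \<bar>?l a - ?l b\<bar>"
  proof -
    let ?D = "insert 1 ((\<lambda>(a, b). \<bar>?l a - ?l b\<bar>) ` {(a, b)\<in>A \<times> A. a \<noteq> b})"
    assume *: "\<forall>a\<in>A. \<forall>b\<in>A - {a}. 0 < \<bar>?l a - ?l b\<bar>"
      and that: "\<And>\<epsilon>. 0 < \<epsilon> \<Longrightarrow> (\<And>a b. a \<in> A \<Longrightarrow> b \<in> A \<Longrightarrow> a \<noteq> b \<Longrightarrow> \<epsilon> < \<bar>?l a - ?l b\<bar>) \<Longrightarrow> thesis"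
    have fin: "finite ?D"
      by (intro finite.insertI finite_imageI finite_subset[OF _ finite_cartesian_product[OF A A]]) auto
    have "Min ?D > 0" using * fin by (subst Min_gr_iff) auto
    moreover have "Min ?D \<le> \<bar>?l a - ?l b\<bar>" if "a \<in> A" "b \<in> A" "a \<noteq> b" for a b
      using fin that by (intro Min_le) auto
    ultimately show thesis by (intro that[of "Min ?D / 2"]) force+
  qed
  define C where "C = (\<Sum>i<m. \<bar>s\<bar> ^ i) + 1"
  have C: "C > 0" unfolding C_def by (intro add_nonneg_pos sum_nonneg) auto
  have l_near: "\<bar>?l x - ?l a\<bar> \<le> \<epsilon> / 2" if "\<And>i. i < m \<Longrightarrow> \<bar>x i - a i\<bar> < \<epsilon> / (2 * C)" for x a
  proof -
    have "\<bar>?l x - ?l a\<bar> = \<bar>\<Sum>i<m. s ^ i * (x i - a i)\<bar>"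
      by (simp add: right_diff_distrib sum_subtractf)
    also have "\<dots> \<le> (\<Sum>i<m. \<bar>s ^ i * (x i - a i)\<bar>)" by (rule sum_abs)
    also have "\<dots> \<le> (\<Sum>i<m. \<bar>s\<bar> ^ i * (\<epsilon> / (2 * C)))"
      unfolding abs_mult power_abs using that
      by (intro sum_mono mult_left_mono) (auto intro: less_imp_le)
    also have "\<dots> = (C - 1) * (\<epsilon> / (2 * C))" unfolding sum_distrib_right[symmetric] by (simp add: C_def)
    also have "\<dots> \<le> C * (\<epsilon> / (2 * C))" using \<epsilon> C by (intro mult_right_mono) auto
    also have "\<dots> = \<epsilon> / 2" using C by simp
    finally show ?thesis .
  qed

  have "\<exists>\<eta>>0. \<forall>y. (\<forall>i<m. \<bar>y i\<bar> < \<eta>) \<longrightarrow>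
      (\<exists>z. (\<forall>i<m. \<bar>z i - a i\<bar> < \<epsilon> / (2 * C)) \<and> (\<forall>i<m. G i z = y i))" if a: "a \<in> A" for a
  proof -
    obtain \<rho> where \<rho>: "\<rho> > 0"
      "\<And>x. (\<forall>i<m. \<bar>x i - a i\<bar> \<le> \<rho>) \<Longrightarrow> F x = 0 \<Longrightarrow> (\<forall>i<m. x i = a i)"
      using iso[OF a] by blast
    define \<rho>' where "\<rho>' = min \<rho> (\<epsilon> / (2 * C))"
    have "\<rho>' > 0" using \<rho> \<epsilon> C by (simp add: \<rho>'_def)
    moreover have "\<forall>i<m. x i = a i" if "\<And>i. i < m \<Longrightarrow> \<bar>x i - a i\<bar> \<le> \<rho>'" "F x = 0" for x
    proof (rule \<rho>(2)[OF _ that(2)], intro allI impI)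
      fix i assume "i < m"
      then show "\<bar>x i - a i\<bar> \<le> \<rho>" using that(1)[of i] by (simp add: \<rho>'_def)
    qed
    ultimately obtain \<eta> where \<eta>: "\<eta> > 0"
      "\<And>y. (\<forall>i<m. \<bar>y i\<bar> < \<eta>) \<Longrightarrow>
        \<exists>z. (\<forall>i<m. \<bar>z i - a i\<bar> < \<rho>') \<and> (\<forall>i<m. G i z = y i)"
      by (rule gradient_surj_near_isolated_zero[OF F nonneg zero[OF a] _ _ G(2)]) (assumption | rule that; assumption)+
    have "\<exists>z. (\<forall>i<m. \<bar>z i - a i\<bar> < \<epsilon> / (2 * C)) \<and> (\<forall>i<m. G i z = y i)" if "\<forall>i<m. \<bar>y i\<bar> < \<eta>" for y
    proof -
      have "\<exists>z. (\<forall>i<m. \<bar>z i - a i\<bar> < \<rho>') \<and> (\<forall>i<m. G i z = y i)" using \<eta>(2) that by blast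
      then show ?thesis unfolding \<rho>'_def min_less_iff_conj by blast
    qed
    then show ?thesis using \<eta>(1) by blast
  qed
  then obtain \<eta> where \<eta>: "\<And>a. a \<in> A \<Longrightarrow> \<eta> a > 0"
    "\<And>a y. a \<in> A \<Longrightarrow> (\<forall>i<m. \<bar>y i\<bar> < \<eta> a) \<Longrightarrow>
      (\<exists>z. (\<forall>i<m. \<bar>z i - a i\<bar> < \<epsilon> / (2 * C)) \<and> (\<forall>i<m. G i z = y i))"
    by metis
  define \<eta>0 where "\<eta>0 = Min (insert 1 (\<eta> ` A))"
  have \<eta>0: "\<eta>0 > 0" "\<And>a. a \<in> A \<Longrightarrow> \<eta>0 \<le> \<eta> a"
    using \<eta>(1) A by (auto simp: \<eta>0_def)
  obtain y where y: "\<And>i. 0 < y i \<and> y i < \<eta>0"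
    "(\<Sum>\<alpha>\<in>exps m (5 ^ m). v j \<alpha> * monom_fun m \<alpha> y) \<noteq> 0"
    using polynomial_nonzero_near_0[OF v(2), of "v j" \<eta>0] v(3) \<eta>0(1) by metis
  have "\<exists>z. (\<forall>i<m. \<bar>z i - a i\<bar> < \<epsilon> / (2 * C)) \<and> (\<forall>i<m. G i z = y i)" if "a \<in> A" for a
  proof (rule \<eta>(2)[OF that], intro allI impI)
    fix i
    show "\<bar>y i\<bar> < \<eta> a" using y(1)[of i] \<eta>0(2)[OF that] by auto
  qed
  then obtain z where z: "\<And>a i. a \<in> A \<Longrightarrow> i < m \<Longrightarrow> \<bar>z a i - a i\<bar> < \<epsilon> / (2 * C)"
    "\<And>a i. a \<in> A \<Longrightarrow> i < m \<Longrightarrow> G i (z a) = y i"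
    by metis

  define c where "c j = (\<Sum>\<beta>\<in>exps m (5 ^ m). v j \<beta> * monom_fun m \<beta> y)" for j
  let ?R = "{t. (\<Sum>j\<le>5 ^ m. c j * t ^ j) = 0}"
  have "inj_on (\<lambda>a. ?l (z a)) A"
  proof (rule inj_onI, rule ccontr)
    fix a b assume ab: "a \<in> A" "b \<in> A" "?l (z a) = ?l (z b)" "a \<noteq> b"
    have "\<bar>?l (z a) - ?l a\<bar> \<le> \<epsilon> / 2" "\<bar>?l (z b) - ?l b\<bar> \<le> \<epsilon> / 2"
      using l_near[of "z a" a] l_near[of "z b" b] z(1) ab by auto
    then show False using \<epsilon>(2)[of a b] ab by linarith
  qed
  moreover have "(\<lambda>a. ?l (z a)) ` A \<subseteq> ?R"
  proof -
    have "monom_fun m \<beta> (\<lambda>i. G i (z a)) = monom_fun m \<beta> y" if "a \<in> A" for a \<beta>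
      unfolding monom_fun_def using z(2)[OF that] by (intro prod.cong) auto
    then have "(\<Sum>j\<le>5 ^ m. c j * ?l (z a) ^ j) = 0" if "a \<in> A" for a
      using v(4)[of "z a"] that by (simp add: c_def)
    then show ?thesis by blast
  qed
  moreover have "c j \<noteq> 0" using y(2) by (simp add: c_def)
  ultimately show ?thesis
    using polyfun_roots_finite[of c j "5 ^ m"] polyfun_roots_card[of c j "5 ^ m"] v(1)
      card_inj_on_le[of "\<lambda>a. ?l (z a)" A ?R] by linarith
qed

section \<open>Computation trees\<close>

fun opnd_val :: "operand \<Rightarrow> (nat \<Rightarrow> real) \<Rightarrow> real" where
  "opnd_val (Reg i) x = x i"
| "opnd_val (Cst c) x = c"

fun in_range :: "nat \<Rightarrow> operand \<Rightarrow> bool" where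
  "in_range r (Reg i) = (i < r)"
| "in_range r (Cst c) = True"

lemma opnd_eq: "opnd m u = (if in_range (length m) u then Some (opnd_val u ((!) m)) else None)"
  by (cases u) auto

lemma poly_fun_opnd_val:
  assumes "in_range r u" "r \<le> m" "0 < d"
  shows "poly_fun m d (opnd_val u)"
proof (cases u)
  case (Reg i)
  then have "poly_fun m (Suc (d - 1)) (\<lambda>x. x i)" using assms by (intro poly_fun.var) auto
  moreover have "opnd_val u = (\<lambda>x. x i)" using Reg by auto
  ultimately show ?thesis using assms(3) by simp
next
  case (Cst c)
  have "opnd_val u = (\<lambda>_. c)" using Cst by auto
  then show ?thesis by (simp add: poly_fun.const)
qed

lemma opnd_val_append: "in_range (length b) u \<Longrightarrow> opnd_val u ((!) (b @ c)) = opnd_val u ((!) b)"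
  by (cases u) (auto simp: nth_append)

lemma opnd_val_close:
  "in_range r u \<Longrightarrow> (\<And>i. i < r \<Longrightarrow> \<bar>x i - y i\<bar> \<le> \<rho>) \<Longrightarrow> 0 \<le> \<rho> \<Longrightarrow> \<bar>opnd_val u x - opnd_val u y\<bar> \<le> \<rho>"
  by (cases u) auto

fun arith_eqn :: "arith_op \<Rightarrow> real \<Rightarrow> real \<Rightarrow> real \<Rightarrow> real" where
  "arith_eqn Add w u v = w - (u + v)"
| "arith_eqn Sub w u v = w - (u - v)"
| "arith_eqn Mul w u v = w - u * v"
| "arith_eqn Div w u v = w * v - u"

lemma arith_eqn_iff:
  "apply_op f u v = Some w \<longleftrightarrow> arith_eqn f w u v = 0 \<and> (f = Div \<longrightarrow> v \<noteq> 0)"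
  by (cases f) (auto simp: field_simps)

lemma poly_fun_arith_eqn:
  assumes "poly_fun m 1 w" "poly_fun m 1 u" "poly_fun m 1 v"
  shows "poly_fun m 2 (\<lambda>x. arith_eqn f (w x) (u x) (v x))"
proof -
  have lin: "poly_fun m 2 w" "poly_fun m 2 u" "poly_fun m 2 v"
    using assms by (auto elim: poly_fun_mono)
  have quad: "poly_fun m 2 (\<lambda>x. g x * h x)" if "poly_fun m 1 g" "poly_fun m 1 h" for g h
    using that by (rule poly_fun.mult) simp
  show ?thesis
    by (cases f) (use lin assms in \<open>auto intro!: poly_fun_diff poly_fun.add quad\<close>)
qed

lemma poly_fun_add_square:
  assumes "poly_fun m 4 F" "poly_fun m 2 e"
  shows "poly_fun m 4 (\<lambda>x. F x + (e x)\<^sup>2)"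
  using poly_fun.add[OF assms(1)] poly_fun_power[OF assms(2), of 2] by simp

definition isolated_accepted :: "act \<Rightarrow> nat \<Rightarrow> ((nat \<Rightarrow> real) \<Rightarrow> real) \<Rightarrow> real list \<Rightarrow> bool" where
  "isolated_accepted T r F a \<longleftrightarrow> length a = r \<and> F ((!) a) = 0 \<and> act_eval T a = Some True \<and>
    (\<exists>\<rho>>0. \<forall>b. length b = r \<longrightarrow> (\<forall>i<r. \<bar>b ! i - a ! i\<bar> \<le> \<rho>) \<longrightarrow> F ((!) b) = 0 \<longrightarrow>
       act_eval T b = Some True \<longrightarrow> b = a)"

lemma isolated_accepted_restrict:
  assumes "isolated_accepted T r F a" "F' ((!) a) = 0" "act_eval T' a = Some True" "\<rho>' > 0"
    and "\<And>b. length b = r \<Longrightarrow> (\<And>i. i < r \<Longrightarrow> \<bar>b ! i - a ! i\<bar> \<le> \<rho>') \<Longrightarrow> F' ((!) b) = 0 \<Longrightarrow>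
      act_eval T' b = Some True \<Longrightarrow> F ((!) b) = 0 \<and> act_eval T b = Some True"
  shows "isolated_accepted T' r F' a"
proof -
  obtain \<rho> where \<rho>: "\<rho> > 0" "\<And>b. length b = r \<Longrightarrow> (\<forall>i<r. \<bar>b ! i - a ! i\<bar> \<le> \<rho>) \<Longrightarrow>
      F ((!) b) = 0 \<Longrightarrow> act_eval T b = Some True \<Longrightarrow> b = a"
    using assms(1) unfolding isolated_accepted_def by blast
  have "b = a" if "length b = r" "\<forall>i<r. \<bar>b ! i - a ! i\<bar> \<le> min \<rho> \<rho>'" "F' ((!) b) = 0"
    "act_eval T' b = Some True" for b
    using \<rho>(2)[of b] assms(5)[of b] that by simp
  then show ?thesis
    using assms \<rho>(1) unfolding isolated_accepted_def by (intro conjI exI[of _ "min \<rho> \<rho>'"]) auto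
qed

lemma isolated_accepted_append:
  assumes "isolated_accepted T r F a" "F' ((!) (a @ [w])) = 0" "act_eval T' (a @ [w]) = Some True" "\<rho>' > 0"
    and "\<And>b w'. length b = r \<Longrightarrow> (\<And>i. i < r \<Longrightarrow> \<bar>b ! i - a ! i\<bar> \<le> \<rho>') \<Longrightarrow> \<bar>w' - w\<bar> \<le> \<rho>' \<Longrightarrow>
      F' ((!) (b @ [w'])) = 0 \<Longrightarrow> act_eval T' (b @ [w']) = Some True \<Longrightarrow>
      F ((!) b) = 0 \<and> act_eval T b = Some True \<and> (b = a \<longrightarrow> w' = w)"
  shows "isolated_accepted T' (Suc r) F' (a @ [w])"
proof -
  obtain \<rho> where \<rho>: "\<rho> > 0" "\<And>b. length b = r \<Longrightarrow> (\<forall>i<r. \<bar>b ! i - a ! i\<bar> \<le> \<rho>) \<Longrightarrow>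
      F ((!) b) = 0 \<Longrightarrow> act_eval T b = Some True \<Longrightarrow> b = a" and len: "length a = r"
    using assms(1) unfolding isolated_accepted_def by blast
  have "c = a @ [w]" if c: "length c = Suc r" "\<forall>i<Suc r. \<bar>c ! i - (a @ [w]) ! i\<bar> \<le> min \<rho> \<rho>'"
    "F' ((!) c) = 0" "act_eval T' c = Some True" for c
  proof -
    obtain b w' where b: "c = b @ [w']" "length b = r"
      using c(1) by (metis length_Suc_conv_rev)
    have "\<bar>b ! i - a ! i\<bar> \<le> min \<rho> \<rho>'" if "i < r" for i
      using c(2)[rule_format, of i] that b len by (simp add: nth_append)
    moreover have "\<bar>w' - w\<bar> \<le> \<rho>'"
      using c(2)[rule_format, of r] b len by (simp add: nth_append)
    ultimately show ?thesis
      using \<rho>(2)[of b] assms(5)[of b w'] c b by simp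
  qed
  then show ?thesis
    using assms \<rho>(1) len unfolding isolated_accepted_def by (intro conjI exI[of _ "min \<rho> \<rho>'"]) auto
qed

lemma card_isolated_accepted_Leaf:
  assumes F: "poly_fun r 4 F" "\<And>x. 0 \<le> F x" and A: "finite A"
    and iso: "\<And>a. a \<in> A \<Longrightarrow> isolated_accepted (Leaf v) r F a"
  shows "card A \<le> 5 ^ r"
proof -
  have len: "length a = r" if "a \<in> A" for a using iso[OF that] by (simp add: isolated_accepted_def)
  have inj: "inj_on (!) A"
    using len by (auto intro!: inj_onI nth_equalityI dest: fun_cong)
  have "card ((!) ` A) \<le> 5 ^ r"
  proof (rule card_isolated_zeros_le[OF F])
    fix x y assume "x \<in> (!) ` A" "y \<in> (!) ` A" and eq: "\<And>i. i < r \<Longrightarrow> x i = y i"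
    then obtain a b where "a \<in> A" "b \<in> A" "x = (!) a" "y = (!) b" by blast
    moreover from this eq len have "a = b" by (intro nth_equalityI) auto
    ultimately show "x = y" by simp
  next
    fix x assume "x \<in> (!) ` A"
    then obtain a where a: "a \<in> A" and x: "x = (!) a" by blast
    then show "F x = 0" using iso by (simp add: isolated_accepted_def)
    obtain \<rho> where \<rho>: "\<rho> > 0" "\<And>b. length b = r \<Longrightarrow> (\<forall>i<r. \<bar>b ! i - a ! i\<bar> \<le> \<rho>) \<Longrightarrow>
        F ((!) b) = 0 \<Longrightarrow> b = a"
      using iso[OF a] by (auto simp: isolated_accepted_def)
    have "\<forall>i<r. y i = x i" if y: "\<forall>i<r. \<bar>y i - x i\<bar> \<le> \<rho>" "F y = 0" for y
    proof -
      have "F ((!) (map y [0..<r])) = F y" by (rule poly_fun_cong[OF F(1)]) simp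
      then have "map y [0..<r] = a" using \<rho>(2)[of "map y [0..<r]"] y by (simp add: x)
      then show ?thesis by (auto simp: x)
    qed
    then show "\<exists>\<rho>>0. \<forall>y. (\<forall>i<r. \<bar>y i - x i\<bar> \<le> \<rho>) \<longrightarrow> F y = 0 \<longrightarrow> (\<forall>i<r. y i = x i)"
      using \<rho>(1) by blast
  qed (use A in auto)
  then show ?thesis using inj by (simp add: card_image)
qed

lemma card_image_append: "card ((\<lambda>a. a @ [w a]) ` A) = card A"
  by (rule card_image) (auto intro: inj_onI)

lemma card_isolated_accepted_le:
  assumes "poly_fun r 4 F" "\<And>x. 0 \<le> F x" "finite A"
    and "\<And>a. a \<in> A \<Longrightarrow> isolated_accepted T r F a"
  shows "card A \<le> 3 ^ act_depth T * 5 ^ (r + act_depth T)"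
  using assms
proof (induction T arbitrary: r F A)
  case (Leaf v)
  then have "card A \<le> 5 ^ r" by (rule card_isolated_accepted_Leaf)
  then show ?case by simp
next
  case (Arith f p q T)
  note F = Arith.prems(1,2)
  note iso = Arith.prems(4)
  show ?case
  proof (cases "A = {}")
    case False
    then obtain a0 where "a0 \<in> A" by blast
    then have rng: "in_range r p" "in_range r q"
      using iso[of a0] by (auto simp: isolated_accepted_def opnd_eq split: option.splits if_splits)
    let ?u = "\<lambda>b. opnd_val p ((!) b)" and ?v = "\<lambda>b. opnd_val q ((!) b)"
    have eval: "act_eval (Arith f p q T) b =
        (case apply_op f (?u b) (?v b) of Some w \<Rightarrow> act_eval T (b @ [w]) | None \<Rightarrow> None)"
      if "length b = r" for b
      using that rng by (simp add: opnd_eq)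
    define w where "w a = the (apply_op f (?u a) (?v a))" for a
    define F' where "F' x = F x + (arith_eqn f (x r) (opnd_val p x) (opnd_val q x))\<^sup>2" for x
    have F': "poly_fun (Suc r) 4 F'" "\<And>x. 0 \<le> F' x"
      unfolding F'_def using rng F
      by (auto intro!: poly_fun_add_square poly_fun_arith_eqn poly_fun_mono[OF F(1)]
          poly_fun_opnd_val[of r] poly_fun.var[of r "Suc r" 0, simplified])
    have F'_iff: "F' ((!) (b @ [y])) = 0 \<longleftrightarrow> F ((!) b) = 0 \<and> arith_eqn f y (?u b) (?v b) = 0"
      if "length b = r" for b y
    proof -
      have "F ((!) (b @ [y])) = F ((!) b)"
        using that by (intro poly_fun_cong[OF F(1)]) (auto simp: nth_append)
      then show ?thesis
        using that rng F(2)[of "(!) b"] by (auto simp: F'_def opnd_val_append add_nonneg_eq_0_iff)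
    qed
    have "isolated_accepted T (Suc r) F' (a @ [w a])" if a: "a \<in> A" for a
    proof -
      have len: "length a = r" and Fa: "F ((!) a) = 0"
        and ev: "act_eval (Arith f p q T) a = Some True"
        using iso[OF a] by (auto simp: isolated_accepted_def)
      have w: "apply_op f (?u a) (?v a) = Some (w a)" and evT: "act_eval T (a @ [w a]) = Some True"
        using ev unfolding eval[OF len] w_def by (auto split: option.splits)
      define \<rho>' where "\<rho>' = (if ?v a = 0 then 1 else \<bar>?v a\<bar> / 2)"
      show ?thesis
      proof (rule isolated_accepted_append[OF iso[OF a]])
        show "F' ((!) (a @ [w a])) = 0" using w Fa by (simp add: F'_iff[OF len] arith_eqn_iff)
        show "\<rho>' > 0" by (simp add: \<rho>'_def)
        fix b y assume b: "length b = r" "\<And>i. i < r \<Longrightarrow> \<bar>b ! i - a ! i\<bar> \<le> \<rho>'"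
          and Fb: "F' ((!) (b @ [y])) = 0" and evb: "act_eval T (b @ [y]) = Some True"
        have "?v b \<noteq> 0" if "?v a \<noteq> 0"
          using opnd_val_close[OF rng(2), of "(!) b" "(!) a" \<rho>'] b(2) that by (auto simp: \<rho>'_def)
        then have "apply_op f (?u b) (?v b) = Some y"
          using Fb w by (simp add: F'_iff[OF b(1)] arith_eqn_iff)
        then show "F ((!) b) = 0 \<and> act_eval (Arith f p q T) b = Some True \<and> (b = a \<longrightarrow> y = w a)"
          using Fb evb w unfolding eval[OF b(1)] by (auto simp: F'_iff[OF b(1)])
      qed (rule evT)
    qed
    then have "card ((\<lambda>a. a @ [w a]) ` A) \<le> 3 ^ act_depth T * 5 ^ (Suc r + act_depth T)"
      using Arith.prems(3) by (intro Arith.IH[OF F']) auto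
    then show ?thesis by (simp add: card_image_append)
  qed simp
next
  case (Sqrt p T)
  note F = Sqrt.prems(1,2)
  note iso = Sqrt.prems(4)
  show ?case
  proof (cases "A = {}")
    case False
    then obtain a0 where "a0 \<in> A" by blast
    then have rng: "in_range r p"
      using iso[of a0] by (auto simp: isolated_accepted_def opnd_eq split: option.splits if_splits)
    let ?u = "\<lambda>b. opnd_val p ((!) b)"
    have eval: "act_eval (Sqrt p T) b = (if ?u b < 0 then None else act_eval T (b @ [sqrt (?u b)]))"
      if "length b = r" for b
      using that rng by (simp add: opnd_eq)
    have F_append: "F ((!) (b @ [y])) = F ((!) b)" if "length b = r" for b y
      using that by (intro poly_fun_cong[OF F(1)]) (auto simp: nth_append)
    have polys: "poly_fun (Suc r) 4 F" "poly_fun (Suc r) 2 (opnd_val p)" "poly_fun (Suc r) 1 (\<lambda>x. x r)"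
      "poly_fun (Suc r) 2 (\<lambda>x. x r)"
      using poly_fun_mono[OF F(1)] poly_fun_opnd_val[OF rng, of "Suc r" 2]
        poly_fun.var[of r "Suc r" 0] poly_fun.var[of r "Suc r" 1] by (auto simp: numeral_2_eq_2)
    let ?B = "3 ^ act_depth T * 5 ^ (Suc r + act_depth T) :: nat"
    let ?A0 = "{a\<in>A. ?u a = 0}" and ?A1 = "{a\<in>A. ?u a > 0}"
    have facts: "length a = r" "F ((!) a) = 0" "0 \<le> ?u a" "act_eval T (a @ [sqrt (?u a)]) = Some True"
      if "a \<in> A" for a
    proof -
      show len: "length a = r" and "F ((!) a) = 0"
        using iso[OF that] by (auto simp: isolated_accepted_def)
      have "act_eval (Sqrt p T) a = Some True" using iso[OF that] by (simp add: isolated_accepted_def)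
      then show "0 \<le> ?u a" "act_eval T (a @ [sqrt (?u a)]) = Some True"
        unfolding eval[OF len] by (auto split: if_splits)
    qed
    txt \<open>Near a zero radicand the equation \<open>y\<^sup>2 = u\<close> would also admit the negative root, so there the
      stronger equations \<open>u = 0\<close> and \<open>y = 0\<close> are imposed instead.\<close>
    have "card ?A0 \<le> ?B"
    proof -
      define F' where "F' x = F x + (opnd_val p x)\<^sup>2 + (x r)\<^sup>2" for x
      have F': "poly_fun (Suc r) 4 F'" "\<And>x. 0 \<le> F' x"
        unfolding F'_def using polys F(2) by (auto intro!: poly_fun_add_square)
      have F'_iff: "F' ((!) (b @ [y])) = 0 \<longleftrightarrow> F ((!) b) = 0 \<and> ?u b = 0 \<and> y = 0"
        if "length b = r" for b y
        using that rng F(2)[of "(!) b"]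
        by (auto simp: F'_def F_append opnd_val_append add_nonneg_eq_0_iff)
      have "isolated_accepted T (Suc r) F' (a @ [0])" if a: "a \<in> ?A0" for a
      proof (rule isolated_accepted_append[OF iso, of _ _ _ _ 1])
        show "a \<in> A" using a by simp
        show "F' ((!) (a @ [0])) = 0" using a facts[of a] by (simp add: F'_iff)
        show "act_eval T (a @ [0]) = Some True" using a facts[of a] by simp
      qed (use eval in \<open>auto simp: F'_iff\<close>)
      then have "card ((\<lambda>a. a @ [0]) ` ?A0) \<le> ?B"
        using Sqrt.prems(3) by (intro Sqrt.IH[OF F']) auto
      then show ?thesis by (simp add: card_image_append)
    qed
    moreover have "card ?A1 \<le> ?B"
    proof -
      define F' where "F' x = F x + (x r * x r - opnd_val p x)\<^sup>2" for x
      have F': "poly_fun (Suc r) 4 F'" "\<And>x. 0 \<le> F' x"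
        unfolding F'_def using polys F(2)
        by (auto intro!: poly_fun_add_square poly_fun_diff intro: poly_fun.mult[OF polys(3) polys(3)])
      have F'_iff: "F' ((!) (b @ [y])) = 0 \<longleftrightarrow> F ((!) b) = 0 \<and> y * y = ?u b"
        if "length b = r" for b y
        using that rng F(2)[of "(!) b"]
        by (auto simp: F'_def F_append opnd_val_append add_nonneg_eq_0_iff)
      have "isolated_accepted T (Suc r) F' (a @ [sqrt (?u a)])" if a: "a \<in> ?A1" for a
      proof (rule isolated_accepted_append[OF iso])
        show "a \<in> A" using a by simp
        show "F' ((!) (a @ [sqrt (?u a)])) = 0" using a facts[of a] by (simp add: F'_iff)
        show "act_eval T (a @ [sqrt (?u a)]) = Some True" using a facts[of a] by simp
        show "sqrt (?u a) / 2 > 0" using a by simp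
        fix b y assume b: "length b = r" and y: "\<bar>y - sqrt (?u a)\<bar> \<le> sqrt (?u a) / 2"
          and Fb: "F' ((!) (b @ [y])) = 0" and evb: "act_eval T (b @ [y]) = Some True"
        have "sqrt (?u a) > 0" using a by simp
        then have "y > 0" using y by linarith
        moreover have u: "F ((!) b) = 0" "y * y = ?u b" using Fb by (simp_all add: F'_iff[OF b])
        ultimately have "sqrt (?u b) = y" "\<not> ?u b < 0"
          by (metis real_sqrt_mult_self real_sqrt_mult abs_of_pos) (metis u(2) zero_le_square not_less)
        then show "F ((!) b) = 0 \<and> act_eval (Sqrt p T) b = Some True \<and> (b = a \<longrightarrow> y = sqrt (?u a))"
          using u evb unfolding eval[OF b] by auto
      qed
      then have "card ((\<lambda>a. a @ [sqrt (?u a)]) ` ?A1) \<le> ?B"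
        using Sqrt.prems(3) by (intro Sqrt.IH[OF F']) auto
      then show ?thesis by (simp add: card_image_append)
    qed
    moreover have "A = ?A0 \<union> ?A1" using facts(3) by force
    then have "card A \<le> card ?A0 + card ?A1" by (metis card_Un_le)
    ultimately show ?thesis by simp
  qed simp
next
  case (Branch p L E G)
  note F = Branch.prems(1,2)
  note iso = Branch.prems(4)
  show ?case
  proof (cases "A = {}")
    case False
    then obtain a0 where "a0 \<in> A" by blast
    then have rng: "in_range r p"
      using iso[of a0] by (auto simp: isolated_accepted_def opnd_eq split: option.splits if_splits)
    let ?u = "\<lambda>b. opnd_val p ((!) b)"
    have eval: "act_eval (Branch p L E G) b =
        (if ?u b < 0 then act_eval L b else if ?u b = 0 then act_eval E b else act_eval G b)"
      if "length b = r" for b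
      using that rng by (simp add: opnd_eq)
    have facts: "length a = r" "F ((!) a) = 0"
      "(if ?u a < 0 then act_eval L a else if ?u a = 0 then act_eval E a else act_eval G a) = Some True"
      if "a \<in> A" for a
      using iso[OF that] eval[of a] by (simp_all add: isolated_accepted_def)
    have same_sign: "?u b \<noteq> 0 \<and> (?u b < 0 \<longleftrightarrow> ?u a < 0)"
      if "\<And>i. i < r \<Longrightarrow> \<bar>b ! i - a ! i\<bar> \<le> \<bar>?u a\<bar> / 2" "?u a \<noteq> 0" for a b
    proof -
      have "\<bar>?u b - ?u a\<bar> \<le> \<bar>?u a\<bar> / 2" using opnd_val_close[OF rng that(1)] by simp
      then show ?thesis using that(2) by arith
    qed
    let ?M = "max (act_depth L) (max (act_depth E) (act_depth G))"
    let ?B = "3 ^ ?M * 5 ^ (r + ?M) :: nat"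
    have mono: "3 ^ d * 5 ^ (r + d) \<le> ?B" if "d \<le> ?M" for d
      using that by (intro mult_mono power_increasing) auto
    let ?AL = "{a\<in>A. ?u a < 0}" and ?AE = "{a\<in>A. ?u a = 0}" and ?AG = "{a\<in>A. ?u a > 0}"
    have "card ?AL \<le> 3 ^ act_depth L * 5 ^ (r + act_depth L)"
    proof (rule Branch.IH(1)[OF F])
      fix a assume a: "a \<in> ?AL"
      show "isolated_accepted L r F a"
      proof (rule isolated_accepted_restrict[OF iso, of _ _ _ "\<bar>?u a\<bar> / 2"])
        fix b assume "length b = r" "\<And>i. i < r \<Longrightarrow> \<bar>b ! i - a ! i\<bar> \<le> \<bar>?u a\<bar> / 2"
          "F ((!) b) = 0" "act_eval L b = Some True"
        then show "F ((!) b) = 0 \<and> act_eval (Branch p L E G) b = Some True"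
          using same_sign[of b a] a eval[of b] by simp
      qed (use a facts[of a] in auto)
    qed (use Branch.prems(3) in simp)
    moreover have "card ?AG \<le> 3 ^ act_depth G * 5 ^ (r + act_depth G)"
    proof (rule Branch.IH(3)[OF F])
      fix a assume a: "a \<in> ?AG"
      show "isolated_accepted G r F a"
      proof (rule isolated_accepted_restrict[OF iso, of _ _ _ "\<bar>?u a\<bar> / 2"])
        fix b assume "length b = r" "\<And>i. i < r \<Longrightarrow> \<bar>b ! i - a ! i\<bar> \<le> \<bar>?u a\<bar> / 2"
          "F ((!) b) = 0" "act_eval G b = Some True"
        then show "F ((!) b) = 0 \<and> act_eval (Branch p L E G) b = Some True"
          using same_sign[of b a] a eval[of b] by simp
      qed (use a facts[of a] in auto)
    qed (use Branch.prems(3) in simp)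
    moreover have "card ?AE \<le> 3 ^ act_depth E * 5 ^ (r + act_depth E)"
    proof -
      define F' where "F' x = F x + (opnd_val p x)\<^sup>2" for x
      have F': "poly_fun r 4 F'" "\<And>x. 0 \<le> F' x"
        unfolding F'_def using F poly_fun_opnd_val[OF rng, of r 2]
        by (auto intro!: poly_fun_add_square)
      have F'_iff: "F' ((!) b) = 0 \<longleftrightarrow> F ((!) b) = 0 \<and> ?u b = 0" for b
        using F(2)[of "(!) b"] by (auto simp: F'_def add_nonneg_eq_0_iff)
      show ?thesis
      proof (rule Branch.IH(2)[OF F'])
        fix a assume a: "a \<in> ?AE"
        show "isolated_accepted E r F' a"
          by (rule isolated_accepted_restrict[OF iso, of _ _ _ 1]) 
             (use a facts[of a] eval in \<open>auto simp: F'_iff\<close>)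
      qed (use Branch.prems(3) in simp)
    qed
    moreover have "A = ?AL \<union> ?AE \<union> ?AG" by force
    then have "card A \<le> card ?AL + card ?AE + card ?AG"
      by (metis (no_types, lifting) card_Un_le order_trans add_right_mono)
    ultimately have "card A \<le> ?B + ?B + ?B"
      using mono[of "act_depth L"] mono[of "act_depth E"] mono[of "act_depth G"] by linarith
    also have "\<dots> \<le> 3 ^ Suc ?M * 5 ^ (r + Suc ?M)" by simp
    finally show ?thesis by simp
  qed simp
qed

section \<open>The point sets\<close>

text \<open>The integers \<open>0, \<dots>, k\<close> followed by half-integers in decreasing order, so that the slots in
  their natural order form a bitonic tour. For even \<open>n\<close> the largest half-integer exceeds \<open>k\<close>.\<close>

definition slot :: "nat \<Rightarrow> nat \<Rightarrow> real" where
  "slot n j = (if j \<le> (n - 1) div 2 then real j else real (n - j) - 1 / 2)"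

lemma slot_separated:
  assumes "i < n" "j < n" "i \<noteq> j"
  shows "1 / 2 \<le> \<bar>slot n i - slot n j\<bar>"
proof -
  have int: "1 \<le> \<bar>real a - real b\<bar>" if "a \<noteq> b" for a b :: nat
    using that by linarith
  have half: "1 / 2 \<le> \<bar>real a - (real b - 1 / 2)\<bar>" for a b :: nat
  proof (cases "a < b")
    case True
    then have "real a + 1 \<le> real b" by linarith
    then show ?thesis by linarith
  qed simp
  have "n - i \<noteq> n - j" using assms by linarith
  then show ?thesis
    using int[of i j] int[of "n - i" "n - j"] half[of i "n - j"] half[of j "n - i"] assms(3)
    unfolding slot_def by (auto simp: abs_minus_commute)
qed

lemma edist_horizontal: "edist (a, 0) (b, 0) = \<bar>a - b\<bar>"
  by (simp add: edist_def)

lemma fst_diff_le_edist: "\<bar>fst p - fst q\<bar> \<le> edist p q"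
  unfolding edist_def by (rule real_le_rsqrt) simp

lemma btsp_yes_permuted_slots:
  assumes n: "n \<ge> 3" and \<pi>: "\<pi> permutes {1..<(n - 1) div 2}"
  shows "btsp_yes (map (\<lambda>j. (slot n (\<pi> j), 0)) [0..<n]) 1"
proof -
  define k where "k = (n - 1) div 2"
  have nk: "n = 2 * k + 1 \<or> n = 2 * k + 2" and k: "1 \<le> k" using n by (auto simp: k_def)
  have slot: "slot n j = (if j \<le> k then real j else real (n - j) - 1 / 2)" for j
    by (simp add: slot_def k_def)
  let ?ps = "map (\<lambda>j. (slot n (\<pi> j), 0)) [0..<n] :: point list"
  let ?\<sigma> = "map (inv \<pi>) [0..<n]"
  have \<pi>n: "\<pi> permutes {0..<n}" using \<pi> by (rule permutes_subset) auto
  have inv_lt: "inv \<pi> i < n" if "i < n" for i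
    using permutes_in_image[OF permutes_inv[OF \<pi>n], of i] that by simp
  have pt: "?ps ! (?\<sigma> ! i) = (slot n i, 0)" if "i < n" for i
    using that inv_lt[OF that] permutes_inverses(1)[OF \<pi>n] by simp
  have "is_tour ?ps ?\<sigma>"
    using n permutes_image[OF permutes_inv[OF \<pi>n]] permutes_inj_on[OF permutes_inv[OF \<pi>n]]
    by (auto simp: is_tour_def distinct_map)
  moreover have "slot n 0 \<le> slot n j" if "j < n" for j
    using that by (auto simp: slot)
  moreover have "slot n i < slot n j" if "i < j" "j \<le> n - 1 - k" for i j
  proof (cases "j \<le> k")
    case False
    then have "n - j = Suc k" "i \<le> k" using that nk by linarith+
    then show ?thesis using False by (auto simp: slot)
  qed (use that in \<open>auto simp: slot\<close>)
  moreover have "slot n j < slot n i" if "n - 1 - k \<le> i" "i < j" "j < n" for i j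
  proof (cases "i \<le> k")
    case True
    then have "i = k" "n - j \<le> k" "\<not> j \<le> k" using that nk by linarith+
    then show ?thesis by (auto simp: slot)
  qed (use that in \<open>auto simp: slot\<close>)
  ultimately have bitonic: "bitonic_tour ?ps ?\<sigma>"
    unfolding bitonic_tour_def using n pt
    by (intro conjI exI[of _ "n - 1 - k"] allI impI) (auto simp del: nth_map)
  have "\<bar>slot n i - slot n ((i + 1) mod n)\<bar> \<le> 1" if i: "i < n" for i
  proof (cases "i + 1 < n")
    case True
    consider "i + 1 \<le> k" | "i = k" | "k < i" by linarith
    then show ?thesis
    proof cases
      case 2
      then have "n - (i + 1) = k \<or> n - (i + 1) = Suc k" using nk by linarith
      then show ?thesis using 2 True by (auto simp: slot)
    qed (use True in \<open>auto simp: slot\<close>)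
  next
    case False
    then have "i + 1 = n" "\<not> i \<le> k" using i nk k by linarith+
    then show ?thesis by (auto simp: slot)
  qed
  then have "bottleneck ?ps ?\<sigma> \<le> 1"
    unfolding bottleneck_def using n pt
    by (subst Max_le_iff) (auto simp: edist_horizontal simp del: nth_map)
  with bitonic show ?thesis unfolding btsp_yes_def by blast
qed

text \<open>The tour is a closed walk through \<open>0\<close> and \<open>k\<close> with steps of width at most 1. One of its two
  arcs between these points has only \<open>k\<close> edges, so this arc visits every integer in between.\<close>

lemma btsp_yes_imp_integers:
  fixes ps :: "point list"
  defines "n \<equiv> length ps"
  defines "k \<equiv> (n - 1) div 2"
  assumes n: "n \<ge> 3" and yes: "btsp_yes ps 1"
    and x0: "fst (ps ! 0) = 0" and pos: "\<And>j. 0 < j \<Longrightarrow> j < n \<Longrightarrow> 0 < fst (ps ! j)"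
    and xk: "fst (ps ! k) = real k"
    and even: "even n \<Longrightarrow> fst (ps ! (k + 1)) = real k + 1 / 2"
    and i: "i \<le> k"
  shows "\<exists>j<n. fst (ps ! j) = real i"
proof -
  obtain \<sigma> where \<sigma>: "bitonic_tour ps \<sigma>" and bot: "bottleneck ps \<sigma> \<le> 1"
    using yes unfolding btsp_yes_def by blast
  have dist: "distinct \<sigma>" and set: "set \<sigma> = {0..<n}"
    and left: "\<And>j. j < length \<sigma> \<Longrightarrow> fst (ps ! (\<sigma> ! 0)) \<le> fst (ps ! (\<sigma> ! j))"
    using \<sigma> by (auto simp: bitonic_tour_def is_tour_def n_def)
  have len: "length \<sigma> = n" using distinct_card[OF dist] set by simp
  have lt: "\<sigma> ! j < n" if "j < n" for j using that set len nth_mem by fastforce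
  have pos_of: "\<exists>j<n. \<sigma> ! j = l" if "l < n" for l
    using that set len by (metis atLeast0LessThan in_set_conv_nth lessThan_iff)
  define X where "X j = fst (ps ! (\<sigma> ! (j mod n)))" for j
  have step: "\<bar>X (Suc j) - X j\<bar> \<le> 1" if "j < n" for j
  proof -
    have "\<bar>X j - X (Suc j)\<bar> \<le> edist (ps ! (\<sigma> ! j)) (ps ! (\<sigma> ! ((j + 1) mod n)))"
      using fst_diff_le_edist that by (simp add: X_def)
    also have "\<dots> \<le> bottleneck ps \<sigma>"
      unfolding bottleneck_def len using that by (intro Max_ge) auto
    finally show ?thesis using bot by linarith
  qed
  have lip: "\<bar>X b - X a\<bar> \<le> real (b - a)" if "a \<le> b" "b \<le> n" for a b
    using that
  proof (induction b rule: dec_induct)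
    case (step b)
    then show ?case using \<open>\<And>j. j < n \<Longrightarrow> \<bar>X (Suc j) - X j\<bar> \<le> 1\<close>[of b] by (simp add: Suc_diff_le)
  qed simp
  have "\<sigma> ! 0 = 0"
  proof (rule ccontr)
    assume "\<sigma> ! 0 \<noteq> 0"
    then have "0 < fst (ps ! (\<sigma> ! 0))" using pos lt[of 0] n by simp
    moreover obtain j where "j < n" "\<sigma> ! j = 0" using pos_of[of 0] n by auto
    ultimately show False using left[of j] x0 len by simp
  qed
  then have X0: "X 0 = 0" "X n = 0" using n x0 by (auto simp: X_def)
  have "k < n" using n unfolding k_def by presburger
  then obtain q where q: "q < n" "\<sigma> ! q = k" using pos_of by blast
  then have Xq: "X q = real k" using xk by (simp add: X_def)
  have far: "real k \<le> real q" "real k \<le> real (n - q)"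
    using lip[of 0 q] lip[of q n] X0 Xq q by auto
  have "q = k \<or> n - q = k"
  proof (cases "even n")
    case True
    then have nk: "n = 2 * k + 2" using n unfolding k_def by presburger
    obtain e where e: "e < n" "\<sigma> ! e = k + 1" using pos_of[of "k + 1"] nk by auto
    then have "X e = real k + 1 / 2" using even True by (simp add: X_def)
    then have "real k < real e" "real k < real (n - e)"
      using lip[of 0 e] lip[of e n] X0 e by auto
    then have "e = k + 1" using nk by linarith
    then have "q \<noteq> k + 1" using e q by auto
    then show ?thesis using far nk q by linarith
  next
    case False
    then have "n = 2 * k + 1" by (simp add: k_def)
    then show ?thesis using far q by linarith
  qed
  then show ?thesis
  proof
    assume "q = k"
    then have "\<bar>X i\<bar> \<le> real i" "\<bar>real k - X i\<bar> \<le> real k - real i"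
      using lip[of 0 i] lip[of i k] i q X0 Xq by auto
    then have "X i = real i" by linarith
    then show ?thesis using i \<open>q = k\<close> q lt[of i] by (auto simp: X_def)
  next
    assume nq: "n - q = k"
    then have "\<bar>X (n - i)\<bar> \<le> real i" "\<bar>X (n - i) - real k\<bar> \<le> real k - real i"
      using lip[of "n - i" n] lip[of q "n - i"] i q X0 Xq by (auto simp: of_nat_diff)
    then have "X (n - i) = real i" by linarith
    then show ?thesis using lt[of "(n - i) mod n"] n by (auto simp: X_def)
  qed
qed

lemma length_encode: "length (encode ps B) = 2 * length ps + 1"
  by (simp add: encode_def length_concat comp_def sum_list_triv)

lemma nth_concat_pairs:
  "j < length ps \<Longrightarrow> concat (map (\<lambda>p. [fst p, snd p]) ps) ! (2 * j) = fst (ps ! j)"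
  "j < length ps \<Longrightarrow> concat (map (\<lambda>p. [fst p, snd p]) ps) ! Suc (2 * j) = snd (ps ! j)"
proof (induction ps arbitrary: j)
  case (Cons p ps)
  { case 1 then show ?case using Cons.IH(1) by (cases j) auto }
  { case 2 then show ?case using Cons.IH(2) by (cases j) auto }
qed auto

lemma nth_encode:
  "j < length ps \<Longrightarrow> encode ps B ! (2 * j) = fst (ps ! j)"
  "j < length ps \<Longrightarrow> encode ps B ! Suc (2 * j) = snd (ps ! j)"
  "encode ps B ! (2 * length ps) = B"
  by (simp_all add: encode_def nth_append nth_concat_pairs length_concat comp_def sum_list_triv)

lemma encode_of_list:
  assumes "length b = 2 * n + 1"
  shows "b = encode (map (\<lambda>j. (b ! (2 * j), b ! Suc (2 * j))) [0..<n]) (b ! (2 * n))" (is "b = encode ?ps ?B")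
proof (rule nth_equalityI)
  fix i assume "i < length b"
  then consider j where "j < n" "i = 2 * j" | j where "j < n" "i = Suc (2 * j)" | "i = 2 * n"
    using assms by (cases "even i") (auto elim!: evenE oddE simp: less_Suc_eq)
  then show "b ! i = encode ?ps ?B ! i"
    by cases (use nth_encode(1,2)[of _ ?ps ?B] nth_encode(3)[of ?ps ?B] in auto)
qed (use assms in \<open>simp add: length_encode\<close>)

definition frame_poly :: "nat \<Rightarrow> (nat \<Rightarrow> real) \<Rightarrow> real" where
  "frame_poly n x = (x (2 * n) - 1)\<^sup>2 + (\<Sum>j<n. (x (Suc (2 * j)))\<^sup>2)
     + (\<Sum>j\<in>{..<n} - {1..<(n - 1) div 2}. (x (2 * j) - slot n j)\<^sup>2)"

lemma poly_fun_frame_poly: "poly_fun (2 * n + 1) 4 (frame_poly n)"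
proof -
  have sq: "poly_fun (2 * n + 1) 4 (\<lambda>x. (x i - c)\<^sup>2)" if "i < 2 * n + 1" for i c
    using poly_fun_power[OF poly_fun_diff[OF poly_fun.var[OF that, of 1] poly_fun.const[of _ _ c]], of 2]
    by simp
  have sq0: "poly_fun (2 * n + 1) 4 (\<lambda>x. (x i)\<^sup>2)" if "i < 2 * n + 1" for i
    using sq[OF that, of 0] by simp
  show ?thesis
    unfolding frame_poly_def[abs_def] by (intro poly_fun.add poly_fun_sum sq sq0) auto
qed

lemma frame_poly_nonneg: "0 \<le> frame_poly n x"
  unfolding frame_poly_def by (intro add_nonneg_nonneg sum_nonneg) auto

lemma frame_poly_eq_0_iff:
  "frame_poly n x = 0 \<longleftrightarrow> x (2 * n) = 1 \<and> (\<forall>j<n. x (Suc (2 * j)) = 0) \<and>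
     (\<forall>j<n. j \<notin> {1..<(n - 1) div 2} \<longrightarrow> x (2 * j) = slot n j)"
proof -
  have "frame_poly n x = 0 \<longleftrightarrow> (x (2 * n) - 1)\<^sup>2 = 0 \<and> (\<Sum>j<n. (x (Suc (2 * j)))\<^sup>2) = 0
     \<and> (\<Sum>j\<in>{..<n} - {1..<(n - 1) div 2}. (x (2 * j) - slot n j)\<^sup>2) = 0"
    unfolding frame_poly_def by (simp add: add_nonneg_eq_0_iff sum_nonneg)
  then show ?thesis by (auto simp: sum_nonneg_eq_0_iff)
qed

lemma act_eval_decides_btsp:
  assumes "decides_btsp n T" "inj_on x {0..<n}"
  defines "ps \<equiv> map (\<lambda>j. (x j, 0)) [0..<n]"
  shows "act_eval T (encode ps 1) = Some (btsp_yes ps 1)"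
proof -
  have "map fst ps = map x [0..<n]" by (simp add: ps_def)
  then have "distinct (map fst ps)" using assms(2) by (metis distinct_map distinct_upt set_upt)
  moreover have "length ps = n" by (simp add: ps_def)
  moreover have "0 < (1 :: real)" by simp
  ultimately show ?thesis using assms(1) unfolding decides_btsp_def by blast
qed

lemma isolated_accepted_permuted_slots:
  assumes n: "n \<ge> 3" and T: "decides_btsp n T" and \<pi>: "\<pi> permutes {1..<(n - 1) div 2}"
  shows "isolated_accepted T (2 * n + 1) (frame_poly n)
    (encode (map (\<lambda>j. (slot n (\<pi> j), 0)) [0..<n]) 1)"
    (is "isolated_accepted _ _ _ (encode ?ps 1)")
proof -
  let ?k = "(n - 1) div 2"
  have \<pi>n: "\<pi> permutes {..<n}" using \<pi> by (rule permutes_subset) auto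
  have \<pi>_lt: "\<pi> j < n" if "j < n" for j using permutes_in_image[OF \<pi>n, of j] that by simp
  have \<pi>_fix: "\<pi> j = j" if "j \<notin> {1..<?k}" for j using permutes_not_in[OF \<pi> that] .
  have sep: "1 / 2 \<le> \<bar>slot n (\<pi> i) - slot n (\<pi> j)\<bar>" if "i < n" "j < n" "i \<noteq> j" for i j
    using that \<pi>_lt permutes_inj[OF \<pi>] by (intro slot_separated) (auto dest: injD)
  have nth: "encode ?ps 1 ! (2 * j) = slot n (\<pi> j)" "encode ?ps 1 ! Suc (2 * j) = 0"
    if "j < n" for j
    using that nth_encode(1,2)[of j ?ps 1] by auto
  have last: "encode ?ps 1 ! (2 * n) = 1" using nth_encode(3)[of ?ps 1] by simp
  have "inj_on (\<lambda>j. slot n (\<pi> j)) {0..<n}"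
  proof (rule inj_onI, rule ccontr)
    fix i j assume "i \<in> {0..<n}" "j \<in> {0..<n}" "slot n (\<pi> i) = slot n (\<pi> j)" "i \<noteq> j"
    then show False using sep[of i j] by simp
  qed
  then have "act_eval T (encode ?ps 1) = Some True"
    using act_eval_decides_btsp[OF T] btsp_yes_permuted_slots[OF n \<pi>] by simp
  moreover have "frame_poly n ((!) (encode ?ps 1)) = 0"
    using nth last \<pi>_fix by (simp add: frame_poly_eq_0_iff)
  moreover have "b = encode ?ps 1"
    if b: "length b = 2 * n + 1" "\<forall>i<2 * n + 1. \<bar>b ! i - encode ?ps 1 ! i\<bar> \<le> 1 / 8"
      "frame_poly n ((!) b) = 0" "act_eval T b = Some True" for b
  proof -
    define x where "x j = b ! (2 * j)" for j
    let ?qs = "map (\<lambda>j. (x j, 0)) [0..<n] :: point list"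
    have B: "b ! (2 * n) = 1" and y: "\<And>j. j < n \<Longrightarrow> b ! Suc (2 * j) = 0"
      and fixed: "\<And>j. j < n \<Longrightarrow> j \<notin> {1..<?k} \<Longrightarrow> x j = slot n j"
      using b(3) by (auto simp: frame_poly_eq_0_iff x_def)
    have "map (\<lambda>j. (b ! (2 * j), b ! Suc (2 * j))) [0..<n] = ?qs"
      using y by (simp add: x_def)
    then have b_eq: "b = encode ?qs 1"
      using encode_of_list[OF b(1)] B by metis
    have close: "\<bar>x j - slot n (\<pi> j)\<bar> \<le> 1 / 8" if "j < n" for j
      using b(2)[rule_format, of "2 * j"] that nth[OF that] by (simp add: x_def)
    have "inj_on x {0..<n}"
    proof (rule inj_onI, rule ccontr)
      fix i j assume ij: "i \<in> {0..<n}" "j \<in> {0..<n}" "x i = x j" "i \<noteq> j"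
      have "1 / 2 \<le> \<bar>slot n (\<pi> i) - slot n (\<pi> j)\<bar>" "\<bar>x i - slot n (\<pi> i)\<bar> \<le> 1 / 8"
        "\<bar>x j - slot n (\<pi> j)\<bar> \<le> 1 / 8"
        using sep[of i j] close[of i] close[of j] ij(1,2,4) by auto
      then show False using ij(3) by linarith
    qed
    then have yes: "btsp_yes ?qs 1"
      using act_eval_decides_btsp[OF T] b(4) b_eq by simp
    have x0: "x 0 = 0" using fixed[of 0] n by (simp add: slot_def)
    have xk: "x ?k = real ?k" using fixed[of ?k] n by (simp add: slot_def)
    have xe: "x (?k + 1) = real ?k + 1 / 2" if "even n"
    proof -
      have "n - (?k + 1) = ?k + 1" "?k + 1 < n" using that n by presburger+
      then show ?thesis using fixed[of "?k + 1"] by (simp add: slot_def)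
    qed
    have pos: "0 < x j" if "0 < j" "j < n" for j
    proof -
      have "0 \<le> slot n (\<pi> j)" using \<pi>_lt[OF that(2)] by (auto simp: slot_def)
      moreover have "slot n (\<pi> 0) = 0" using \<pi>_fix[of 0] by (simp add: slot_def)
      moreover have "1 / 2 \<le> \<bar>slot n (\<pi> 0) - slot n (\<pi> j)\<bar>" using sep[of 0 j] that by simp
      ultimately show ?thesis using close[OF that(2)] by linarith
    qed
    have "x j = slot n (\<pi> j)" if j: "j < n" for j
    proof (cases "j \<in> {1..<?k}")
      case True
      then have "\<pi> j \<in> {1..<?k}" using permutes_in_image[OF \<pi>] by simp
      then have \<pi>j: "\<pi> j \<le> ?k" "slot n (\<pi> j) = real (\<pi> j)" by (auto simp: slot_def)
      then obtain l where l: "l < n" "x l = real (\<pi> j)"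
        using btsp_yes_imp_integers[of ?qs "\<pi> j"] yes n x0 xk xe pos by auto
      have "l = j"
      proof (rule ccontr)
        assume "l \<noteq> j"
        then show False using sep[OF l(1) j] close[OF l(1)] l(2) \<pi>j(2) by linarith
      qed
      then show ?thesis using l \<pi>j by simp
    qed (use fixed \<pi>_fix j in simp)
    then have "?qs = ?ps" by simp
    then show ?thesis using b_eq by (simp only:)
  qed
  ultimately show ?thesis
    unfolding isolated_accepted_def by (auto simp: length_encode intro!: exI[of _ "1 / 8"])
qed

lemma fact_le_of_decides_btsp:
  assumes n: "n \<ge> 3" and T: "decides_btsp n T"
  shows "fact ((n - 1) div 2 - 1) \<le> (3 ^ act_depth T * 5 ^ (2 * n + 1 + act_depth T) :: nat)"
proof -
  let ?k = "(n - 1) div 2"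
  let ?P = "{\<pi>. \<pi> permutes {1..<?k}}"
  let ?code = "\<lambda>\<pi>. encode (map (\<lambda>j. (slot n (\<pi> j), 0)) [0..<n]) 1"
  have "inj_on ?code ?P"
  proof (rule inj_onI, rule ext)
    fix \<pi> \<pi>' j assume \<pi>: "\<pi> \<in> ?P" and \<pi>': "\<pi>' \<in> ?P" and eq: "?code \<pi> = ?code \<pi>'"
    show "\<pi> j = \<pi>' j"
    proof (cases "j \<in> {1..<?k}")
      case True
      then have j: "j < n" by auto
      have "\<pi> j \<in> {1..<?k}" "\<pi>' j \<in> {1..<?k}"
        using True \<pi> \<pi>' permutes_in_image by fastforce+
      moreover have "slot n (\<pi> j) = slot n (\<pi>' j)"
        using j nth_encode(1)[of j "map (\<lambda>j. (slot n (\<pi> j), 0)) [0..<n]" 1]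
          nth_encode(1)[of j "map (\<lambda>j. (slot n (\<pi>' j), 0)) [0..<n]" 1] eq by simp
      ultimately show ?thesis by (simp add: slot_def)
    next
      case False
      then show ?thesis using \<pi> \<pi>' permutes_not_in[of \<pi>] permutes_not_in[of \<pi>'] by simp
    qed
  qed
  then have "card (?code ` ?P) = fact (?k - 1)"
    by (simp add: card_image card_permutations)
  moreover have "card (?code ` ?P) \<le> 3 ^ act_depth T * 5 ^ (2 * n + 1 + act_depth T)"
    using isolated_accepted_permuted_slots[OF n T] finite_permutations[of "{1..<?k}"]
    by (intro card_isolated_accepted_le[OF poly_fun_frame_poly frame_poly_nonneg]) auto
  ultimately show ?thesis by simp
qed

lemma ln_fact_ge:
  assumes "q > 0"
  shows "real q * ln (real q) - real q \<le> ln (fact q)"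
proof -
  have "(\<Sum>i\<in>{q}. inverse (fact i) * real q ^ i) \<le> (\<Sum>i. inverse (fact i) * real q ^ i)"
    by (rule sum_le_suminf) (auto intro: summable_exp)
  also have "\<dots> = exp (real q)"
    using exp_converges[of "real q"] by (simp add: sums_iff)
  finally have "real q ^ q / fact q \<le> exp (real q)" by (simp add: field_simps)
  then have "ln (real q ^ q / fact q) \<le> real q"
    using assms by (subst (asm) ln_le_cancel_iff[symmetric]) auto
  then show ?thesis using assms by (simp add: ln_div ln_realpow)
qed

theorem theorem14:
  shows "\<exists>c>0. \<exists>N. \<forall>n\<ge>N. \<forall>T. decides_btsp n T \<longrightarrow>
           real (act_depth T) \<ge> c * real n * ln (real n)"
proof -
  have "eventually (\<lambda>n::nat. real n * ln (real n) / 8 \<le>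
      real n / 4 * ln (real n / 4) - real n - (2 * real n + 1) * ln 5) at_top"
    by real_asymp
  then obtain N0 where N0: "\<And>n. n \<ge> N0 \<Longrightarrow> real n * ln (real n) / 8 \<le>
      real n / 4 * ln (real n / 4) - real n - (2 * real n + 1) * ln 5"
    by (auto simp: eventually_at_top_linorder)
  define c :: real where "c = 1 / (8 * ln 15)"
  have "c * real n * ln (real n) \<le> real (act_depth T)"
    if n: "n \<ge> max 8 N0" and T: "decides_btsp n T" for n T
  proof -
    define q where "q = (n - 1) div 2 - 1"
    let ?h = "act_depth T"
    have q: "real n / 4 \<le> real q" "real q \<le> real n"
      using n by (auto simp: q_def)
    have "real n / 4 * ln (real n / 4) - real n \<le> real q * ln (real q) - real q"
      using q n by (intro diff_mono mult_mono) auto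
    also have "\<dots> \<le> ln (fact q)" using q n by (intro ln_fact_ge) auto
    also have "\<dots> \<le> ln (3 ^ ?h * 5 ^ (2 * n + 1 + ?h))"
    proof -
      have "real (fact q) \<le> real (3 ^ ?h * 5 ^ (2 * n + 1 + ?h))"
        using fact_le_of_decides_btsp[OF _ T] n unfolding of_nat_le_iff q_def by simp
      then show ?thesis by (subst ln_le_cancel_iff) auto
    qed
    also have "(3::real) ^ ?h * 5 ^ (2 * n + 1 + ?h) = 15 ^ ?h * 5 ^ (2 * n + 1)"
      by (simp add: power_add power_mult_distrib[symmetric])
    also have "ln \<dots> = real ?h * ln 15 + (2 * real n + 1) * ln 5"
      by (subst ln_mult) (auto simp: ln_realpow simp del: power_Suc power_add)
    finally have "real n * ln (real n) / 8 \<le> real ?h * ln 15" using N0[of n] n by simp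
    then show ?thesis by (simp add: c_def field_simps)
  qed
  moreover have "c > 0" by (simp add: c_def)
  ultimately show ?thesis by blast
qed

end
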